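(* For every fixed constant $q\ge 1$, the Generalized Multiway Cut on Trees (GMWCT) problem restricted to instances with exactly $q$ terminal sets can be solved in linear time; that is, there is an algorithm that, given an instance $(T,\{S_1,\ldots,S_q\},k)$ of GMWCT with $n=|V(T)|$, correctly decides whether it is a yes-instance in time $O(n)$, where the constant hidden in the $O$-notation may depend on $q$ (but not on $n$ or $k$).
   Context: Generalized Multiway Cut on Trees (GMWCT). Given: a tree $T$ (a finite connected acyclic undirected graph), a collection of vertex subsets (terminal sets) $S_1,\ldots,S_q\subseteq V(T)$, and a non-negative integer $k$. Question: is there a set $E'\subseteq E(T)$ with $|E'|\le k$ such that for every $i=1,\ldots,q$ and every pair of distinct vertices $u,v\in S_i$ there is no path between $u$ and $v$ in the graph $T-E'=(V(T),E(T)\setminus E')$? An instance is a yes-instance if the answer is yes. Running time is measured in the usual unit-cost model, in which arithmetic operations and comparisons on the numbers involved take constant time. *)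

theory Defs
  imports "HOL-Library.Landau_Symbols"
begin

section \<open>Undirected graphs and trees\<close>

text \<open>A finite simple undirected graph is given by its vertex set \<open>V\<close> and its edge set \<open>E\<close>,
  an edge being a two-element subset of \<open>V\<close>.\<close>

definition simple_graph :: "'a set \<Rightarrow> 'a set set \<Rightarrow> bool" where
  "simple_graph V E \<longleftrightarrow> finite V \<and> (\<forall>e\<in>E. e \<subseteq> V \<and> card e = 2)"

definition is_path :: "'a set \<Rightarrow> 'a set set \<Rightarrow> 'a \<Rightarrow> 'a list \<Rightarrow> 'a \<Rightarrow> bool" where
  "is_path V E u p v \<longleftrightarrow> p \<noteq> [] \<and> hd p = u \<and> last p = v \<and> set p \<subseteq> V \<and> distinct p
     \<and> successively (\<lambda>x y. {x, y} \<in> E) p"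

definition is_cycle :: "'a set \<Rightarrow> 'a set set \<Rightarrow> 'a list \<Rightarrow> bool" where
  "is_cycle V E c \<longleftrightarrow> length c \<ge> 3 \<and> set c \<subseteq> V \<and> distinct c
     \<and> successively (\<lambda>x y. {x, y} \<in> E) c \<and> {last c, hd c} \<in> E"

definition connected_graph :: "'a set \<Rightarrow> 'a set set \<Rightarrow> bool" where
  "connected_graph V E \<longleftrightarrow> V \<noteq> {} \<and> (\<forall>u\<in>V. \<forall>v\<in>V. \<exists>p. is_path V E u p v)"

definition tree :: "'a set \<Rightarrow> 'a set set \<Rightarrow> bool" where
  "tree V E \<longleftrightarrow> simple_graph V E \<and> connected_graph V E \<and> (\<nexists>c. is_cycle V E c)"

section \<open>Generalized Multiway Cut on Trees\<close>

text \<open>The collection of terminal sets is a list, so repetitions are allowed.\<close>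

definition gmwct_instance :: "'a set \<Rightarrow> 'a set set \<Rightarrow> 'a set list \<Rightarrow> bool" where
  "gmwct_instance V E Ss \<longleftrightarrow> tree V E \<and> (\<forall>S\<in>set Ss. S \<subseteq> V)"

definition gmwct_yes :: "'a set \<Rightarrow> 'a set set \<Rightarrow> 'a set list \<Rightarrow> nat \<Rightarrow> bool" where
  "gmwct_yes V E Ss k \<longleftrightarrow>
     (\<exists>E'\<subseteq>E. card E' \<le> k \<and>
        (\<forall>S\<in>set Ss. \<forall>u\<in>S. \<forall>v\<in>S. u \<noteq> v \<longrightarrow> (\<nexists>p. is_path V (E - E') u p v)))"

section \<open>Unit-cost random access machines\<close>

text \<open>A random access machine with a read-only input tape, registers that hold natural numbers of
  arbitrary size, indirect addressing, and unit cost for every instruction. Subtraction is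
  truncated at zero. There is deliberately no multiplication or division: together with the unit
  cost criterion on unbounded numbers they would make the machine unrealistically powerful.
  Reading beyond the end of the input yields zero.\<close>

datatype instr =
    Read nat
  | Const nat nat
  | Move nat nat
  | Load nat nat
  | Store nat nat
  | Add nat nat nat
  | Sub nat nat nat
  | Jump nat
  | JumpLess nat nat nat

type_synonym program = "instr list"

text \<open>Configurations: program counter, register contents, unread part of the input.\<close>

type_synonym config = "nat \<times> (nat \<Rightarrow> nat) \<times> nat list"

fun exec :: "instr \<Rightarrow> config \<Rightarrow> config" where
  "exec (Read i) (pc, r, xs) =
     (Suc pc, r(i := (case xs of [] \<Rightarrow> 0 | x # _ \<Rightarrow> x)), tl xs)"
| "exec (Const i c) (pc, r, xs) = (Suc pc, r(i := c), xs)"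
| "exec (Move i j) (pc, r, xs) = (Suc pc, r(i := r j), xs)"
| "exec (Load i j) (pc, r, xs) = (Suc pc, r(i := r (r j)), xs)"
| "exec (Store i j) (pc, r, xs) = (Suc pc, r(r i := r j), xs)"
| "exec (Add i j l) (pc, r, xs) = (Suc pc, r(i := r j + r l), xs)"
| "exec (Sub i j l) (pc, r, xs) = (Suc pc, r(i := r j - r l), xs)"
| "exec (Jump a) (pc, r, xs) = (a, r, xs)"
| "exec (JumpLess i j a) (pc, r, xs) = (if r i < r j then a else Suc pc, r, xs)"

text \<open>The machine halts when the program counter leaves the program.\<close>

definition halted :: "program \<Rightarrow> config \<Rightarrow> bool" where
  "halted P c \<longleftrightarrow> fst c \<ge> length P"

definition step :: "program \<Rightarrow> config \<Rightarrow> config" where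
  "step P c = (if halted P c then c else exec (P ! fst c) c)"

definition initial :: "nat list \<Rightarrow> config" where
  "initial xs = (0, \<lambda>_. 0, xs)"

text \<open>On input \<open>xs\<close> the program halts after at most \<open>t\<close> instructions, leaving the answer \<open>b\<close>
  (one for yes, zero for no) in register zero.\<close>

definition answers_within :: "program \<Rightarrow> nat list \<Rightarrow> nat \<Rightarrow> bool \<Rightarrow> bool" where
  "answers_within P xs t b \<longleftrightarrow>
     (\<exists>s\<le>t. let c = (step P ^^ s) (initial xs)
            in halted P c \<and> fst (snd c) 0 = (if b then 1 else 0))"

section \<open>Presentation of instances to the machine\<close>

text \<open>As usual, the vertices of an input graph are numbered \<open>0, \<dots>, n - 1\<close>. An instance is written
  as the number of vertices, the parameter \<open>k\<close>, the list of edges and the lists of the elements of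
  the terminal sets, each list preceded by its length. The edges, the two endpoints of each edge,
  and the elements of each terminal set may come in any order.\<close>

definition input_word ::
    "nat \<Rightarrow> nat \<Rightarrow> (nat \<times> nat) list \<Rightarrow> nat list list \<Rightarrow> nat list" where
  "input_word n k es ss =
     [n, k, length es] @ concat (map (\<lambda>(u, v). [u, v]) es)
       @ concat (map (\<lambda>s. length s # s) ss)"

definition encodes ::
    "nat list \<Rightarrow> nat set \<Rightarrow> nat set set \<Rightarrow> nat set list \<Rightarrow> nat \<Rightarrow> bool" where
  "encodes xs V E Ss k \<longleftrightarrow>
     (\<exists>n es ss. V = {..<n}
        \<and> set (map (\<lambda>(u, v). {u, v}) es) = E \<and> distinct (map (\<lambda>(u, v). {u, v}) es)
        \<and> map set ss = Ss \<and> (\<forall>s\<in>set ss. distinct s)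
        \<and> xs = input_word n k es ss)"

end

(* Number the terminal sets by 0, ..., q - 1. For a vertex x and a set A of indices let f x A be the
   least number of cuts in the part of the tree already merged into x such that the component of x
   meets there at most one vertex of each S_i with i in A and none of the other terminal sets. A leaf
   u is merged into its neighbour p either by cutting the edge, at cost f p A + f u {0..<q} + 1, or by
   keeping it, at cost f p B + f u (A - B) for some subset B of A. These are at most 4^q operations.
   Leaves are found without adjacency lists: for each vertex the machine stores its degree and the
   sum of its neighbours, and the latter is the only neighbour once the degree is one. Scanning the
   vertices in order and climbing from each one as long as a leaf is reached removes all edges
   in linear time, because an acyclic graph with an edge has a leaf. *)
theory Submission
  imports Defs "HOL-Library.Nat_Bijection"
begin

section \<open>Leaves, paths and reachability\<close>

text \<open>Allowing more indices never costs more, so a vertex cut off from its neighbour may be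
  granted all of them; hence the full set in the price of a cut. Intermediate graphs are only
  forests and carry no root, so correctness is stated for labellings: \<open>L x\<close> is the set
  of indices that \<open>x\<close> reserves for the part merged into it, and distinct vertices of
  one component must reserve disjoint sets. A stripped vertex stays as an isolated vertex of cost
  zero, so the vertex set and the objective keep their shape. Since \<open>q\<close> is fixed, index
  sets are enumerated when the program is generated, not when it runs: merging becomes straight-line
  code, and multiplication by the record length becomes a constant number of additions. Timing then
  reduces to counting iterations of loops without inner loops. The scan and the climb share one
  loop, with the remaining edges plus the unscanned vertices as potential.\<close>

definition nbrs :: "'a set set \<Rightarrow> 'a \<Rightarrow> 'a set" where
  "nbrs E v = {w. {v, w} \<in> E}"

definition adj :: "'a set set \<Rightarrow> ('a \<times> 'a) set" where
  "adj E = {(x, y). {x, y} \<in> E}"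

lemma adj_empty [simp]: "adj {} = {}"
  by (simp add: adj_def)

lemma nbrs_subset: "simple_graph V E \<Longrightarrow> nbrs E v \<subseteq> V"
  by (auto simp: simple_graph_def nbrs_def)

lemma finite_nbrs: "simple_graph V E \<Longrightarrow> finite (nbrs E v)"
  by (meson finite_subset nbrs_subset simple_graph_def)

lemma finite_edges: "simple_graph V E \<Longrightarrow> finite E"
  by (auto simp: simple_graph_def intro: finite_subset[of _ "Pow V"])

lemma simple_graph_edgeD:
  "simple_graph V E \<Longrightarrow> {u, v} \<in> E \<Longrightarrow> u \<in> V \<and> v \<in> V \<and> u \<noteq> v"
  by (auto simp: simple_graph_def doubleton_eq_iff dest!: bspec[of E])

lemma simple_graph_mono: "simple_graph V E \<Longrightarrow> F \<subseteq> E \<Longrightarrow> simple_graph V F"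
  by (auto simp: simple_graph_def)

lemma is_cycle_mono: "is_cycle V F c \<Longrightarrow> V \<subseteq> V' \<Longrightarrow> F \<subseteq> E \<Longrightarrow> is_cycle V' E c"
  unfolding is_cycle_def by (auto intro: successively_mono)

lemma nbrs_insert:
  "u \<noteq> v \<Longrightarrow> nbrs (insert {u, v} E) w =
     (if w = u then insert v (nbrs E w) else if w = v then insert u (nbrs E w) else nbrs E w)"
  by (auto simp: nbrs_def doubleton_eq_iff)

lemma nbrs_delete:
  "u \<noteq> v \<Longrightarrow> nbrs (E - {{u, v}}) w =
     (if w = u then nbrs E w - {v} else if w = v then nbrs E w - {u} else nbrs E w)"
  by (auto simp: nbrs_def doubleton_eq_iff)

text \<open>The first vertex of a longest path is a leaf: a second neighbour would either prolong
  the path or, lying on it, close a cycle.\<close>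

lemma acyclic_has_leaf:
  assumes G: "simple_graph V E" and ac: "\<nexists>c. is_cycle V E c" and ne: "E \<noteq> {}"
  obtains u where "u \<in> V" "card (nbrs E u) = 1"
proof -
  define Q where "Q p \<longleftrightarrow> set p \<subseteq> V \<and> distinct p \<and> successively (\<lambda>x y. {x, y} \<in> E) p \<and> length p \<ge> 2" for p
  have fV: "finite V" using G by (simp add: simple_graph_def)
  obtain e where e: "e \<in> E" using ne by blast
  then obtain a b where "e = {a, b}" "a \<noteq> b"
    using G by (metis card_2_iff simple_graph_def)
  then have "Q [a, b]"
    using e G by (auto simp: Q_def simple_graph_def)
  moreover have bound: "\<forall>p. Q p \<longrightarrow> length p \<le> card V"
    using fV by (metis Q_def card_mono distinct_card)
  ultimately obtain p where p: "Q p" and max: "\<And>p'. Q p' \<Longrightarrow> length p' \<le> length p"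
    using ex_has_greatest_nat[of Q "[a, b]" length "Suc (card V)"] by (auto simp: less_Suc_eq_le)
  then obtain x y ps where ps: "p = x # y # ps"
    by (cases p; cases "tl p") (auto simp: Q_def)
  have y: "y \<in> nbrs E x" using p by (auto simp: Q_def ps nbrs_def)
  have "z = y" if z: "z \<in> nbrs E x" for z
  proof (rule ccontr)
    assume zy: "z \<noteq> y"
    have zE: "{z, x} \<in> E" using z by (simp add: nbrs_def insert_commute)
    have zV: "z \<in> V" "z \<noteq> x" using simple_graph_edgeD[OF G zE] by auto
    show False
    proof (cases "z \<in> set p")
      case False
      then have "Q (z # p)" using p zE zV by (auto simp: Q_def ps)
      then show False using max[of "z # p"] by simp
    next
      case True
      then have "z \<in> set ps" using zy zV by (auto simp: ps)
      then obtain ys zs where sp: "ps = ys @ z # zs" by (meson split_list)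
      \<comment> \<open>The segment from \<open>x\<close> to \<open>z\<close> runs through
        \<open>y\<close>, which gives the cycle its three vertices.\<close>
      have "is_cycle V E (x # y # ys @ [z])"
        using p zE unfolding is_cycle_def
        by (auto simp: Q_def ps sp successively_append_iff successively_Cons hd_append split: if_splits)
      then show False using ac by blast
    qed
  qed
  then have "nbrs E x = {y}" using y by blast
  then show ?thesis using that[of x] p by (auto simp: Q_def ps)
qed

lemma leafE:
  assumes G: "simple_graph V E" and "card (nbrs E u) = 1"
  obtains p where "nbrs E u = {p}" "{u, p} \<in> E" "u \<in> V" "p \<in> V" "u \<noteq> p"
proof -
  obtain p where p: "nbrs E u = {p}" using assms(2) by (auto simp: card_1_singleton_iff)
  then have "{u, p} \<in> E" by (auto simp: nbrs_def)
  then show ?thesis using that p simple_graph_edgeD[OF G] by blast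
qed

text \<open>Deleting a leaf together with its edge lowers both counts by one. The estimate serves to
  bound numbers of iterations.\<close>

lemma acyclic_card_edges:
  assumes "simple_graph V E" "\<nexists>c. is_cycle V E c"
  shows "card E \<le> card V"
  using assms
proof (induction "card E" arbitrary: V E)
  case (Suc m)
  then have "E \<noteq> {}" by auto
  then obtain u where u: "card (nbrs E u) = 1" using acyclic_has_leaf[OF Suc.prems] by auto
  obtain p where p: "nbrs E u = {p}" "{u, p} \<in> E" "u \<in> V" "p \<in> V" "u \<noteq> p"
    using leafE[OF Suc.prems(1) u] .
  let ?E = "E - {{u, p}}" and ?V = "V - {u}"
  have fin: "finite E" "finite V" using finite_edges Suc.prems by (auto simp: simple_graph_def)
  \<comment> \<open>The deleted edge was the only one at \<open>u\<close>, so \<open>u\<close> can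
    leave the vertex set as well.\<close>
  have "u \<notin> e" if "e \<in> ?E" for e
  proof
    assume "u \<in> e"
    moreover have "card e = 2" using that Suc.prems by (simp add: simple_graph_def)
    ultimately obtain w where w: "e = {u, w}" by (auto simp: card_2_iff)
    then have "w \<in> nbrs E u" using that by (simp add: nbrs_def)
    then show False using that p(1) w by simp
  qed
  then have "simple_graph ?V ?E" using Suc.prems(1) by (auto simp: simple_graph_def)
  moreover have "\<nexists>c. is_cycle ?V ?E c"
    using Suc.prems(2) is_cycle_mono[of ?V ?E _ V E] by (metis Diff_subset)
  moreover have "m = card ?E" using Suc.hyps(2) p(2) fin by simp
  ultimately have "card ?E \<le> card ?V" using Suc.hyps(1) by blast
  moreover have "card E = Suc (card ?E)" "card V = Suc (card ?V)"
    using card_Suc_Diff1[OF fin(1) p(2)] card_Suc_Diff1[OF fin(2) p(3)] by auto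
  ultimately show ?case by simp
qed simp

section \<open>Simple paths versus the reachability closure\<close>

lemma path_imp_reach:
  assumes "is_path V E u p v" shows "(u, v) \<in> (adj E)\<^sup>*"
proof -
  have "p \<noteq> [] \<Longrightarrow> successively (\<lambda>x y. {x, y} \<in> E) p \<Longrightarrow> (hd p, last p) \<in> (adj E)\<^sup>*"
    by (induction p rule: induct_list012)
      (auto simp: adj_def intro: converse_rtrancl_into_rtrancl)
  then show ?thesis using assms by (auto simp: is_path_def)
qed

text \<open>The path grows along the closure; a step back onto it truncates it at that vertex.
  Separation arguments can thus work with \<open>(adj E)\<^sup>*\<close> alone.\<close>

lemma reach_imp_path:
  assumes "simple_graph V E" "(u, v) \<in> (adj E)\<^sup>*" "u \<in> V"
  shows "\<exists>p. is_path V E u p v"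
  using assms(2)
proof (induction rule: rtrancl_induct)
  case base
  then show ?case using assms(3) by (intro exI[of _ "[u]"]) (simp add: is_path_def)
next
  case (step y z)
  then obtain p where p: "is_path V E u p y" by blast
  have yz: "{y, z} \<in> E" using step by (simp add: adj_def)
  then have z: "z \<in> V" using simple_graph_edgeD[OF assms(1)] by blast
  show ?case
  proof (cases "z \<in> set p")
    case True
    then obtain ys zs where "p = ys @ z # zs" by (meson split_list)
    then have "is_path V E u (ys @ [z]) z"
      using p by (cases ys) (auto simp: is_path_def successively_append_iff successively_Cons hd_append)
    then show ?thesis by blast
  next
    case False
    then have "is_path V E u (p @ [z]) z"
      using p yz z by (auto simp: is_path_def successively_append_iff)
    then show ?thesis by blast
  qed
qed

section \<open>The residual problem of leaf stripping\<close>

text \<open>The residual problem of a partially stripped tree: \<open>f x A\<close> is the cost of the part already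
  merged into \<open>x\<close> under the condition that the component of \<open>x\<close> meets there only terminal sets
  with index in \<open>A\<close>, each at most once.\<close>

definition feasible ::
    "'i set \<Rightarrow> 'a set \<Rightarrow> 'a set set \<Rightarrow> ('a \<Rightarrow> 'i set \<Rightarrow> nat) \<Rightarrow> nat \<Rightarrow> bool" where
  "feasible U V E f k \<longleftrightarrow> (\<exists>E' L. E' \<subseteq> E \<and> (\<forall>x. L x \<subseteq> U)
     \<and> (\<forall>x y. x \<noteq> y \<longrightarrow> (x, y) \<in> (adj (E - E'))\<^sup>* \<longrightarrow> L x \<inter> L y = {})
     \<and> card E' + (\<Sum>x\<in>V. f x (L x)) \<le> k)"

text \<open>The index set is an allowance, so enlarging it must not raise the cost. This invariant
  makes the full set optimal for a vertex that has been cut off.\<close>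

definition antitone_cost :: "'i set \<Rightarrow> ('i set \<Rightarrow> nat) \<Rightarrow> bool" where
  "antitone_cost U g \<longleftrightarrow> (\<forall>A B. A \<subseteq> B \<longrightarrow> B \<subseteq> U \<longrightarrow> g B \<le> g A)"

lemma antitone_costD: "antitone_cost U g \<Longrightarrow> A \<subseteq> B \<Longrightarrow> B \<subseteq> U \<Longrightarrow> g B \<le> g A"
  by (simp add: antitone_cost_def)

text \<open>Either the edge to the leaf is cut, or the two sides share the index set \<open>A\<close>.\<close>

definition join :: "'i set \<Rightarrow> ('i set \<Rightarrow> nat) \<Rightarrow> ('i set \<Rightarrow> nat) \<Rightarrow> 'i set \<Rightarrow> nat" where
  "join U g h A = Min (insert (g A + h U + 1) ((\<lambda>B. g B + h (A - B)) ` Pow A))"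

lemma
  assumes "finite A"
  shows join_le_cut: "join U g h A \<le> g A + h U + 1"
    and join_le_keep: "B \<subseteq> A \<Longrightarrow> join U g h A \<le> g B + h (A - B)"
    and join_cases: "join U g h A = g A + h U + 1 \<or> (\<exists>B\<subseteq>A. join U g h A = g B + h (A - B))"
proof -
  let ?S = "insert (g A + h U + 1) ((\<lambda>B. g B + h (A - B)) ` Pow A)"
  have fin: "finite ?S" using assms by simp
  show "join U g h A \<le> g A + h U + 1" unfolding join_def using fin by (intro Min_le) auto
  show "join U g h A \<le> g B + h (A - B)" if "B \<subseteq> A"
    unfolding join_def using fin that by (intro Min_le) auto
  have "join U g h A \<in> ?S" unfolding join_def using fin by (intro Min_in) auto
  then show "join U g h A = g A + h U + 1 \<or> (\<exists>B\<subseteq>A. join U g h A = g B + h (A - B))" by auto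
qed

text \<open>A split that is optimal for \<open>A\<close> is reused for \<open>B\<close>: the
  parent's share stays the same and the surplus goes to the leaf.\<close>

lemma antitone_join:
  assumes "finite U" "antitone_cost U g" "antitone_cost U h"
  shows "antitone_cost U (join U g h)"
  unfolding antitone_cost_def
proof (intro allI impI)
  fix A B assume AB: "A \<subseteq> B" "B \<subseteq> U"
  then have fin: "finite A" "finite B" using assms(1) by (auto intro: finite_subset)
  consider "join U g h A = g A + h U + 1" | C where "C \<subseteq> A" "join U g h A = g C + h (A - C)"
    using join_cases[OF fin(1)] by blast
  then show "join U g h B \<le> join U g h A"
  proof cases
    case 1
    then show ?thesis
      using join_le_cut[OF fin(2), of U g h] antitone_costD[OF assms(2) AB] by simp
  next
    case 2
    then have "h (B - C) \<le> h (A - C)" using AB by (intro antitone_costD[OF assms(3)]) auto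
    then show ?thesis using join_le_keep[OF fin(2), of C U g h] 2 AB by fastforce
  qed
qed

text \<open>Sending \<open>u\<close> to \<open>p\<close> turns each step of a walk into a step
  avoiding the edge \<open>{u, p}\<close> or into no step at all, because every step at
  \<open>u\<close> leads to or from \<open>p\<close>.\<close>

lemma reach_contract_leaf:
  assumes "nbrs F u \<subseteq> {p}" "(x, y) \<in> (adj F)\<^sup>*"
  defines "c \<equiv> (\<lambda>z. if z = u then p else z)"
  shows "(c x, c y) \<in> (adj (F - {{u, p}}))\<^sup>*"
  using assms(2)
proof (induction rule: rtrancl_induct)
  case (step y z)
  have "c y = c z \<or> (c y, c z) \<in> adj (F - {{u, p}})"
    using step(2) assms(1) by (auto simp: adj_def nbrs_def c_def doubleton_eq_iff insert_commute)
  then show ?case using step(3) by (auto intro: rtrancl_into_rtrancl)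
qed simp

lemma reach_isolated:
  assumes "nbrs F u = {}"
  shows "(u, x) \<in> (adj F)\<^sup>* \<longleftrightarrow> x = u" "(x, u) \<in> (adj F)\<^sup>* \<longleftrightarrow> x = u"
proof -
  have "(u, x) \<notin> adj F" "(x, u) \<notin> adj F" for x
    using assms by (auto simp: adj_def nbrs_def insert_commute)
  then show "(u, x) \<in> (adj F)\<^sup>* \<longleftrightarrow> x = u" "(x, u) \<in> (adj F)\<^sup>* \<longleftrightarrow> x = u"
    by (auto elim: converse_rtranclE rtranclE)
qed

lemma sum_two:
  fixes h :: "'a \<Rightarrow> nat"
  assumes "finite V" "u \<in> V" "p \<in> V" "u \<noteq> p"
  shows "sum h V = h u + h p + sum h (V - {u, p})"
  using assms by (simp add: sum.remove[of V u] sum.remove[of "V - {u}" p] Diff_insert2[symmetric] add.assoc)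

text \<open>Labellings are translated in both directions. If the edge is cut, the leaf is alone and
  may use \<open>U\<close>; if it is kept, leaf and parent divide between them the label that the
  parent holds after the merge. \<open>join\<close> minimises over these options.\<close>

lemma feasible_leaf:
  assumes fin: "finite V" "finite E" "finite U"
    and leaf: "nbrs E u = {p}" and up: "u \<in> V" "p \<in> V" "u \<noteq> p"
    and mono: "antitone_cost U (f u)"
  shows "feasible U V E f k \<longleftrightarrow>
    feasible U V (E - {{u, p}}) (f(u := \<lambda>_. 0, p := join U (f p) (f u))) k"
    (is "_ \<longleftrightarrow> feasible U V ?E ?f k")
proof
  have e: "{u, p} \<in> E" using leaf by (auto simp: nbrs_def)
  have sums: "(\<Sum>x\<in>V. f x (L x)) = f u (L u) + f p (L p) + (\<Sum>x\<in>V-{u,p}. f x (L x))"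
    "(\<Sum>x\<in>V. ?f x (L x)) = join U (f p) (f u) (L p) + (\<Sum>x\<in>V-{u,p}. f x (L x))" for L
    using up by (auto simp: sum_two[OF fin(1) up] intro!: sum.cong)
  have sub: "adj (?E - F) \<subseteq> adj (E - F)" for F by (auto simp: adj_def)
  {
    assume "feasible U V E f k"
    then obtain E' L where E': "E' \<subseteq> E" and L: "\<And>x. L x \<subseteq> U"
      and dis: "\<And>x y. x \<noteq> y \<Longrightarrow> (x, y) \<in> (adj (E - E'))\<^sup>* \<Longrightarrow> L x \<inter> L y = {}"
      and cost: "card E' + (\<Sum>x\<in>V. f x (L x)) \<le> k"
      unfolding feasible_def by blast
    have finL: "finite (L x)" for x using L fin(3) by (rule finite_subset)
    show "feasible U V ?E ?f k"
    proof (cases "{u, p} \<in> E'")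
      case True
      \<comment> \<open>The edge is absent on both sides, so the surviving graph and its
        disjointness condition do not change.\<close>
      have "?E - (E' - {{u, p}}) = E - E'" using True by blast
      moreover have "f u U \<le> f u (L u)" using mono L by (auto simp: antitone_cost_def)
      then have "card (E' - {{u, p}}) + (\<Sum>x\<in>V. ?f x (L x)) \<le> k"
        using cost join_le_cut[OF finL, of U "f p" "f u" p] True finite_subset[OF E' fin(2)]
          card_Suc_Diff1[of E' "{u, p}"]
        unfolding sums by simp
      ultimately show ?thesis using E' L dis unfolding feasible_def
        by (intro exI[of _ "E' - {{u, p}}"] exI[of _ L]) auto
    next
      case False
      \<comment> \<open>The parent takes over the label of the leaf, which is left isolated with an
        empty label.\<close>
      define L' where "L' = L(u := {}, p := L p \<union> L u)"
      have pu: "(p, u) \<in> adj (E - E')" "(u, p) \<in> adj (E - E')" using e False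
        by (auto simp: adj_def insert_commute)
      then have disj: "L p \<inter> L u = {}" using dis up(3) by blast
      have iso: "nbrs (?E - E') u = {}" using leaf by (auto simp: nbrs_def)
      have "L' x \<inter> L' y = {}" if "x \<noteq> y" "(x, y) \<in> (adj (?E - E'))\<^sup>*" for x y
      proof -
        have r: "(x, y) \<in> (adj (E - E'))\<^sup>*" using that(2) rtrancl_mono[OF sub] by blast
        have xu: "x \<noteq> u" "y \<noteq> u" using that reach_isolated[OF iso] by auto
        \<comment> \<open>A vertex connected to \<open>p\<close> is connected to \<open>u\<close>
          through the kept edge, so its label also avoids the part inherited from
          \<open>u\<close>.\<close>
        show ?thesis
          using dis[OF that(1) r] xu that(1)
            dis[of x u] rtrancl_into_rtrancl[OF r, of u]
            dis[of u y] converse_rtrancl_into_rtrancl[OF _ r, of u] pu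
          by (auto simp: L'_def)
      qed
      moreover have "join U (f p) (f u) (L' p) \<le> f p (L p) + f u (L u)"
        using join_le_keep[of "L p \<union> L u" "L p" U "f p" "f u"] finL disj
        by (simp add: L'_def Un_Diff Diff_triv Int_commute)
      moreover have "(\<Sum>x\<in>V-{u,p}. f x (L' x)) = (\<Sum>x\<in>V-{u,p}. f x (L x))"
        by (intro sum.cong) (auto simp: L'_def)
      moreover have "\<forall>x. L' x \<subseteq> U" using L by (auto simp: L'_def)
      ultimately show ?thesis using cost E' False unfolding feasible_def sums
        by (intro exI[of _ E'] exI[of _ L']) auto
    qed
  next
    assume "feasible U V ?E ?f k"
    then obtain E' L where E': "E' \<subseteq> ?E" and L: "\<And>x. L x \<subseteq> U"
      and dis: "\<And>x y. x \<noteq> y \<Longrightarrow> (x, y) \<in> (adj (?E - E'))\<^sup>* \<Longrightarrow> L x \<inter> L y = {}"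
      and cost: "card E' + (\<Sum>x\<in>V. ?f x (L x)) \<le> k"
      unfolding feasible_def by blast
    have finL: "finite (L p)" using L fin(3) by (rule finite_subset)
    consider "join U (f p) (f u) (L p) = f p (L p) + f u U + 1"
      | B where "B \<subseteq> L p" "join U (f p) (f u) (L p) = f p B + f u (L p - B)"
      using join_cases[OF finL] by blast
    then show "feasible U V E f k"
    proof cases
      case 1
      \<comment> \<open>The additional cut edge is paid by the \<open>+ 1\<close> in
        \<open>join\<close>; being isolated, \<open>u\<close> may use all indices.\<close>
      let ?L = "L(u := U)" and ?E' = "insert {u, p} E'"
      have eq: "E - ?E' = ?E - E'" by blast
      have iso: "nbrs (?E - E') u = {}" using leaf by (auto simp: nbrs_def)
      have "?L x \<inter> ?L y = {}" if "x \<noteq> y" "(x, y) \<in> (adj (E - ?E'))\<^sup>*" for x y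
        using that dis[of x y] reach_isolated[OF iso] unfolding eq by auto
      moreover have "(\<Sum>x\<in>V-{u,p}. f x (?L x)) = (\<Sum>x\<in>V-{u,p}. f x (L x))"
        by (intro sum.cong) auto
      moreover have "card ?E' = Suc (card E')"
        using E' finite_subset[OF E'] fin(2) by (subst card_insert_disjoint) auto
      moreover have "\<forall>x. ?L x \<subseteq> U" using L by auto
      ultimately show ?thesis using cost E' 1 up(3) e unfolding feasible_def sums
        by (intro exI[of _ ?E'] exI[of _ ?L]) auto
    next
      case (2 B)
      \<comment> \<open>\<open>B\<close> is the split at which \<open>join\<close> attains its
        minimum. Contraction maps \<open>u\<close> and \<open>p\<close> to \<open>p\<close>, whose
        old label is divided disjointly between them.\<close>
      let ?L = "L(u := L p - B, p := B)"
      have leaf': "nbrs (E - E') u \<subseteq> {p}" using leaf by (auto simp: nbrs_def)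
      have eq: "E - E' - {{u, p}} = ?E - E'" by blast
      have "?L x \<inter> ?L y = {}" if xy: "x \<noteq> y" "(x, y) \<in> (adj (E - E'))\<^sup>*" for x y
        using reach_contract_leaf[OF leaf' xy(2)] dis[of x y] dis[of x p] dis[of p y] xy(1) 2(1)
        unfolding eq by (auto split: if_splits)
      moreover have "(\<Sum>x\<in>V-{u,p}. f x (?L x)) = (\<Sum>x\<in>V-{u,p}. f x (L x))"
        by (intro sum.cong) auto
      moreover have "\<forall>x. ?L x \<subseteq> U" using L 2(1) by auto
      ultimately show ?thesis using cost E' 2 up(3) e unfolding feasible_def sums
        by (intro exI[of _ E'] exI[of _ ?L]) auto
    qed
  }
qed

text \<open>Without edges the labels do not interact, so every vertex takes the full set, which is
  cheapest.\<close>

lemma feasible_no_edges: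
  assumes "\<And>x. x \<in> V \<Longrightarrow> antitone_cost U (f x)"
  shows "feasible U V {} f k \<longleftrightarrow> (\<Sum>x\<in>V. f x U) \<le> k"
proof
  assume "feasible U V {} f k"
  then obtain L where "\<And>x. L x \<subseteq> U" "(\<Sum>x\<in>V. f x (L x)) \<le> k"
    by (auto simp: feasible_def)
  moreover from this have "(\<Sum>x\<in>V. f x U) \<le> (\<Sum>x\<in>V. f x (L x))"
    using assms by (intro sum_mono) (auto simp: antitone_cost_def)
  ultimately show "(\<Sum>x\<in>V. f x U) \<le> k" by linarith
next
  assume "(\<Sum>x\<in>V. f x U) \<le> k"
  then show "feasible U V {} f k"
    unfolding feasible_def by (intro exI[of _ "{}"] exI[of _ "\<lambda>_. U"]) simp
qed

section \<open>GMWCT as an instance of the residual problem\<close>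

text \<open>The penalty \<open>Suc k\<close> exceeds the budget and thus stands for infinite cost.\<close>

definition terminal_cost :: "'a set list \<Rightarrow> nat \<Rightarrow> 'a \<Rightarrow> nat set \<Rightarrow> nat" where
  "terminal_cost Ss k x A = (if \<exists>i<length Ss. x \<in> Ss ! i \<and> i \<notin> A then Suc k else 0)"

lemma antitone_terminal_cost: "antitone_cost U (terminal_cost Ss k x)"
  by (auto simp: antitone_cost_def terminal_cost_def)

text \<open>In one direction \<open>x\<close> is labelled by the indices of the sets containing it,
  which incurs no penalty. In the other, a single penalty exceeds the budget, so every label must
  contain these indices, and disjointness separates the terminals.\<close>

lemma gmwct_yes_iff_feasible:
  assumes G: "simple_graph V E" and Ss: "\<And>S. S \<in> set Ss \<Longrightarrow> S \<subseteq> V"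
  shows "gmwct_yes V E Ss k \<longleftrightarrow> feasible {..<length Ss} V E (terminal_cost Ss k) k"
proof
  assume "gmwct_yes V E Ss k"
  then obtain E' where E': "E' \<subseteq> E" "card E' \<le> k"
    and sep: "\<forall>S\<in>set Ss. \<forall>u\<in>S. \<forall>v\<in>S. u \<noteq> v \<longrightarrow> (\<nexists>p. is_path V (E - E') u p v)"
    unfolding gmwct_yes_def by auto
  define L where "L x = {i. i < length Ss \<and> x \<in> Ss ! i}" for x
  have "L x \<inter> L y = {}" if xy: "x \<noteq> y" "(x, y) \<in> (adj (E - E'))\<^sup>*" for x y
  proof (rule ccontr)
    assume "L x \<inter> L y \<noteq> {}"
    then obtain i where i: "i < length Ss" "x \<in> Ss ! i" "y \<in> Ss ! i" by (auto simp: L_def)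
    moreover from this have "x \<in> V" using Ss[OF nth_mem] by auto
    moreover have "simple_graph V (E - E')" using G by (rule simple_graph_mono) blast
    ultimately obtain p where "is_path V (E - E') x p y" using reach_imp_path xy(2) by metis
    then show False using sep nth_mem[OF i(1)] i xy(1) by blast
  qed
  moreover have "(\<Sum>x\<in>V. terminal_cost Ss k x (L x)) = 0"
    by (intro sum.neutral) (auto simp: terminal_cost_def L_def)
  ultimately show "feasible {..<length Ss} V E (terminal_cost Ss k) k"
    using E' unfolding feasible_def by (intro exI[of _ E'] exI[of _ L]) (auto simp: L_def)
next
  assume "feasible {..<length Ss} V E (terminal_cost Ss k) k"
  then obtain E' L where E': "E' \<subseteq> E"
    and dis: "\<And>x y. x \<noteq> y \<Longrightarrow> (x, y) \<in> (adj (E - E'))\<^sup>* \<Longrightarrow> L x \<inter> L y = {}"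
    and cost: "card E' + (\<Sum>x\<in>V. terminal_cost Ss k x (L x)) \<le> k"
    unfolding feasible_def by blast
  have fV: "finite V" using G by (simp add: simple_graph_def)
  have L: "i \<in> L x" if "i < length Ss" "x \<in> Ss ! i" for i x
  proof (rule ccontr)
    assume "i \<notin> L x"
    then have "terminal_cost Ss k x (L x) = Suc k" using that by (auto simp: terminal_cost_def)
    moreover have "x \<in> V" using that Ss[OF nth_mem] by auto
    ultimately have "Suc k \<le> (\<Sum>x\<in>V. terminal_cost Ss k x (L x))"
      using member_le_sum[of x V "\<lambda>x. terminal_cost Ss k x (L x)"] fV by simp
    then show False using cost by simp
  qed
  have "False" if S: "S \<in> set Ss" "u \<in> S" "v \<in> S" "u \<noteq> v" and p: "is_path V (E - E') u p v"
    for S u v p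
  proof -
    obtain i where i: "i < length Ss" "Ss ! i = S" using S(1) by (auto simp: in_set_conv_nth)
    then have "i \<in> L u \<inter> L v" using L S by auto
    then show False using dis[OF S(4) path_imp_reach[OF p]] by blast
  qed
  then show "gmwct_yes V E Ss k" using E' cost unfolding gmwct_yes_def by (intro exI[of _ E']) auto
qed

section \<open>Structured programs and timed Hoare triples\<close>

text \<open>Tests compare two registers, as the machine's only conditional jump does.
  \<open>Input\<close> is kept apart from \<open>Do\<close> because it consumes the tape, so that
  \<open>Do\<close> is a pure transformation of registers.\<close>

datatype com =
    Do "instr list"
  | Input nat
  | Seq com com
  | If nat nat com com
  | While nat nat com

primrec clen :: "com \<Rightarrow> nat" where
  "clen (Do is) = length is"
| "clen (Input i) = 1"
| "clen (Seq c d) = clen c + clen d"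
| "clen (If i j c d) = 2 + clen c + clen d"
| "clen (While i j c) = 3 + clen c"

text \<open>Jump targets are absolute, hence the start address \<open>a\<close>. The conditional
  jump is taken when the test succeeds, which places the negative branch first.\<close>

primrec compile :: "nat \<Rightarrow> com \<Rightarrow> program" where
  "compile a (Do is) = is"
| "compile a (Input i) = [Read i]"
| "compile a (Seq c d) = compile a c @ compile (a + clen c) d"
| "compile a (If i j c d) =
     JumpLess i j (a + 2 + clen d) # compile (a + 1) d
       @ Jump (a + 2 + clen d + clen c) # compile (a + 2 + clen d) c"
| "compile a (While i j c) =
     [JumpLess i j (a + 2), Jump (a + 3 + clen c)] @ compile (a + 2) c @ [Jump a]"

text \<open>Both branches of \<open>If\<close> are counted, a harmless overestimate. The
  \<open>2\<close> of \<open>While\<close> covers the two jumps of an iteration and also the two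
  executed on leaving the loop, so \<open>m\<close> iterations and the exit fit into
  \<open>m + 1\<close> times this cost.\<close>

primrec cost :: "com \<Rightarrow> nat" where
  "cost (Do is) = length is"
| "cost (Input i) = 1"
| "cost (Seq c d) = cost c + cost d"
| "cost (If i j c d) = 2 + cost c + cost d"
| "cost (While i j c) = 2 + cost c"

lemma length_compile [simp]: "length (compile a c) = clen c"
  by (induction c arbitrary: a) auto

fun plain :: "instr \<Rightarrow> bool" where
  "plain (Read i) = False"
| "plain (Jump a) = False"
| "plain (JumpLess i j a) = False"
| "plain _ = True"

fun update :: "instr \<Rightarrow> (nat \<Rightarrow> nat) \<Rightarrow> nat \<Rightarrow> nat" where
  "update (Const i c) r = r(i := c)"
| "update (Move i j) r = r(i := r j)"
| "update (Load i j) r = r(i := r (r j))"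
| "update (Store i j) r = r(r i := r j)"
| "update (Add i j l) r = r(i := r j + r l)"
| "update (Sub i j l) r = r(i := r j - r l)"
| "update _ r = r"

abbreviation run :: "instr list \<Rightarrow> (nat \<Rightarrow> nat) \<Rightarrow> nat \<Rightarrow> nat" where
  "run \<equiv> fold update"

lemma exec_plain: "plain i \<Longrightarrow> exec i (a, r, xs) = (Suc a, update i r, xs)"
  by (cases i) auto

section \<open>Execution of code at a given address\<close>

definition located :: "program \<Rightarrow> nat \<Rightarrow> program \<Rightarrow> bool" where
  "located p a c \<longleftrightarrow> (\<exists>b d. p = b @ c @ d \<and> length b = a)"

lemma located_append:
  "located p a (c @ d) \<longleftrightarrow> located p a c \<and> located p (a + length c) d"
proof
  assume "located p a (c @ d)"
  then obtain b e where "p = b @ c @ d @ e" "length b = a" by (auto simp: located_def)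
  then show "located p a c \<and> located p (a + length c) d"
    unfolding located_def by (metis append.assoc length_append)
next
  assume "located p a c \<and> located p (a + length c) d"
  then obtain b e b' e' where *: "p = b @ c @ e" "length b = a" "p = b' @ d @ e'" "length b' = a + length c"
    unfolding located_def by (elim conjE exE)
  then have "b' = b @ c" by (metis append_eq_append_conv append.assoc length_append)
  then show "located p a (c @ d)" using * unfolding located_def by (metis append.assoc)
qed

lemma located_Cons:
  "located p a (i # c) \<longleftrightarrow> located p a [i] \<and> located p (Suc a) c"
  using located_append[of p a "[i]" c] by simp

lemma step_located: "located p a [i] \<Longrightarrow> step p (a, r, xs) = exec i (a, r, xs)"
  by (auto simp: located_def step_def halted_def nth_append)

lemma step_located_Cons: "located p a (i # c) \<Longrightarrow> step p (a, r, xs) = exec i (a, r, xs)"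
  using located_Cons step_located by blast

definition reaches :: "program \<Rightarrow> config \<Rightarrow> nat \<Rightarrow> config \<Rightarrow> bool" where
  "reaches p s t s' \<longleftrightarrow> (step p ^^ t) s = s'"

lemma reaches_0: "reaches p s 0 s"
  by (simp add: reaches_def)

lemma reaches_Suc: "reaches p (step p s) t s' \<Longrightarrow> reaches p s (Suc t) s'"
  by (simp add: reaches_def funpow_Suc_right del: funpow.simps)

lemma reaches_trans: "reaches p s t s' \<Longrightarrow> reaches p s' t' s'' \<Longrightarrow> reaches p s (t + t') s''"
  by (subst add.commute) (simp add: reaches_def funpow_add)

lemma reaches_snoc: "reaches p s t s' \<Longrightarrow> reaches p s (Suc t) (step p s')"
  by (simp add: reaches_def)

lemma reaches_run:
  assumes "located p a is" "\<forall>i\<in>set is. plain i"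
  shows "reaches p (a, r, xs) (length is) (a + length is, run is r, xs)"
  using assms
proof (induction "is" arbitrary: a r)
  case Nil
  then show ?case by (simp add: reaches_0)
next
  case (Cons i "is")
  then have "step p (a, r, xs) = (Suc a, update i r, xs)"
    using step_located_Cons exec_plain by (metis list.set_intros(1))
  moreover have "reaches p (Suc a, update i r, xs) (length is) (Suc a + length is, run is (update i r), xs)"
    using Cons located_Cons by (metis list.set_intros(2))
  ultimately show ?case by (simp add: reaches_Suc)
qed

type_synonym assn = "(nat \<Rightarrow> nat) \<Rightarrow> nat list \<Rightarrow> bool"

text \<open>A triple with a time bound. Programs without loops satisfy it with \<open>b = 0\<close>; every loop may
  iterate up to \<open>b\<close> times provided that its body contains no loop. This makes the bound
  compositional without any explicit time in the assertions.\<close>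

definition triple :: "nat \<Rightarrow> assn \<Rightarrow> com \<Rightarrow> assn \<Rightarrow> bool" where
  "triple b P c Q \<longleftrightarrow> (\<forall>p a r xs. located p a (compile a c) \<longrightarrow> P r xs \<longrightarrow>
     (\<exists>t r' xs'. t \<le> cost c * (b + 1) \<and> reaches p (a, r, xs) t (a + clen c, r', xs') \<and> Q r' xs'))"

lemma triple_conseq:
  "triple b P c Q \<Longrightarrow> (\<And>r xs. P' r xs \<Longrightarrow> P r xs) \<Longrightarrow> (\<And>r xs. Q r xs \<Longrightarrow> Q' r xs) \<Longrightarrow> triple b P' c Q'"
  unfolding triple_def by meson

lemma triple_Do:
  assumes "\<forall>i\<in>set is. plain i"
  shows "triple b (\<lambda>r xs. Q (run is r) xs) (Do is) Q"
  unfolding triple_def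
proof (intro allI impI)
  fix p a r xs assume "located p a (compile a (Do is))" "Q (run is r) xs"
  then show "\<exists>t r' xs'. t \<le> cost (Do is) * (b + 1) \<and>
      reaches p (a, r, xs) t (a + clen (Do is), r', xs') \<and> Q r' xs'"
    using reaches_run[of p a "is" r xs] assms
    by (intro exI[of _ "length is"] exI[of _ "run is r"] exI[of _ xs]) simp
qed

lemma triple_Input:
  "triple b (\<lambda>r xs. xs \<noteq> [] \<and> Q (r(i := hd xs)) (tl xs)) (Input i) Q"
  unfolding triple_def
proof (intro allI impI)
  fix p a r xs
  assume l: "located p a (compile a (Input i))" and Q: "xs \<noteq> [] \<and> Q (r(i := hd xs)) (tl xs)"
  have "reaches p (a, r, xs) 1 (a + 1, r(i := hd xs), tl xs)"
    using l Q by (auto simp: reaches_def step_located neq_Nil_conv)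
  then show "\<exists>t r' xs'. t \<le> cost (Input i) * (b + 1) \<and>
      reaches p (a, r, xs) t (a + clen (Input i), r', xs') \<and> Q r' xs'"
    using Q by (intro exI[of _ 1] exI[of _ "r(i := hd xs)"] exI[of _ "tl xs"]) auto
qed

lemma triple_Seq:
  assumes "triple b P c Q" "triple b Q d R"
  shows "triple b P (Seq c d) R"
  unfolding triple_def
proof (intro allI impI)
  fix p a r xs assume l: "located p a (compile a (Seq c d))" and P: "P r xs"
  from l have l1: "located p a (compile a c)" and l2: "located p (a + clen c) (compile (a + clen c) d)"
    by (auto simp: located_append)
  obtain t r' xs' where t: "t \<le> cost c * (b + 1)" "reaches p (a, r, xs) t (a + clen c, r', xs')" "Q r' xs'"
    using assms(1) l1 P unfolding triple_def by blast
  obtain t' r'' xs'' where t': "t' \<le> cost d * (b + 1)"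
    "reaches p (a + clen c, r', xs') t' (a + clen c + clen d, r'', xs'')" "R r'' xs''"
    using assms(2) l2 t(3) unfolding triple_def by blast
  have "t + t' \<le> cost (Seq c d) * (b + 1)" using t(1) t'(1) by (simp add: algebra_simps)
  then show "\<exists>t r' xs'. t \<le> cost (Seq c d) * (b + 1) \<and>
      reaches p (a, r, xs) t (a + clen (Seq c d), r', xs') \<and> R r' xs'"
    using reaches_trans[OF t(2) t'(2)] t'(3) by (auto simp: add.assoc)
qed

lemma triple_If:
  assumes "triple b (\<lambda>r xs. P r xs \<and> r i < r j) c Q" "triple b (\<lambda>r xs. P r xs \<and> \<not> r i < r j) d Q"
  shows "triple b P (If i j c d) Q"
  unfolding triple_def
proof (intro allI impI)
  fix p a r xs assume l: "located p a (compile a (If i j c d))" and P: "P r xs"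
  let ?a = "a + 2 + clen d"
  have l1: "located p a [JumpLess i j ?a]" and l2: "located p (Suc a) (compile (Suc a) d)"
    and l3: "located p (Suc a + clen d) [Jump (?a + clen c)]" and l4: "located p ?a (compile ?a c)"
    using l by (auto simp: located_append located_Cons[of _ _ _ "_ @ _"] located_Cons[of _ _ _ "compile _ _"])
  show "\<exists>t r' xs'. t \<le> cost (If i j c d) * (b + 1) \<and>
      reaches p (a, r, xs) t (a + clen (If i j c d), r', xs') \<and> Q r' xs'"
  proof (cases "r i < r j")
    case True
    then obtain t r' xs' where t: "t \<le> cost c * (b + 1)" "reaches p (?a, r, xs) t (?a + clen c, r', xs')" "Q r' xs'"
      using assms(1) l4 P unfolding triple_def by blast
    have "reaches p (a, r, xs) (Suc t) (?a + clen c, r', xs')"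
      using t(2) step_located[OF l1] True by (intro reaches_Suc) simp
    then show ?thesis using t by (intro exI[of _ "Suc t"] exI[of _ r'] exI[of _ xs']) (auto simp: algebra_simps)
  next
    case False
    then obtain t r' xs' where t: "t \<le> cost d * (b + 1)"
      "reaches p (Suc a, r, xs) t (Suc a + clen d, r', xs')" "Q r' xs'"
      using assms(2) l2 P unfolding triple_def by blast
    have "reaches p (a, r, xs) (Suc t) (Suc a + clen d, r', xs')"
      using t(2) step_located[OF l1] False by (intro reaches_Suc) simp
    then have "reaches p (a, r, xs) (Suc (Suc t)) (?a + clen c, r', xs')"
      using reaches_snoc step_located[OF l3] by fastforce
    then show ?thesis using t by (intro exI[of _ "Suc (Suc t)"] exI[of _ r'] exI[of _ xs']) (auto simp: algebra_simps)
  qed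
qed

text \<open>Time parameter \<open>0\<close> gives the body a fixed number of steps, and a decreasing
  measure that starts at most at \<open>b\<close> limits the iterations. The rule thus suits loops
  without inner loops, and the algorithm is arranged accordingly.\<close>

lemma triple_While:
  assumes body: "\<And>m. triple 0 (\<lambda>r xs. I m r xs \<and> r i < r j) c (\<lambda>r xs. \<exists>m'<m. I m' r xs)"
  shows "triple b (\<lambda>r xs. \<exists>m\<le>b. I m r xs) (While i j c) (\<lambda>r xs. (\<exists>m. I m r xs) \<and> \<not> r i < r j)"
  unfolding triple_def
proof (intro allI impI)
  fix p a r xs assume l: "located p a (compile a (While i j c))" and "\<exists>m\<le>b. I m r xs"
  then obtain m where m: "m \<le> b" "I m r xs" by blast
  have l1: "located p a [JumpLess i j (a + 2)]" and l2: "located p (Suc a) [Jump (a + 3 + clen c)]"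
    and l3: "located p (a + 2) (compile (a + 2) c)" and l4: "located p (a + 2 + clen c) [Jump a]"
    using l by (auto simp: located_append located_Cons[of _ _ _ "_ # _"] located_Cons[of _ _ _ "_ @ _"])
  have "\<exists>t r' xs'. t \<le> (2 + cost c) * (m + 1) \<and>
      reaches p (a, r, xs) t (a + 3 + clen c, r', xs') \<and> (\<exists>m. I m r' xs') \<and> \<not> r' i < r' j"
    using m(2)
  proof (induction m arbitrary: r xs rule: less_induct)
    case (less m)
    show ?case
    proof (cases "r i < r j")
      case True
      then obtain t r' xs' m' where t: "t \<le> cost c" "reaches p (a + 2, r, xs) t (a + 2 + clen c, r', xs')"
        "m' < m" "I m' r' xs'"
        using body[of m] l3 less.prems unfolding triple_def by fastforce
      have "reaches p (a, r, xs) (Suc t) (a + 2 + clen c, r', xs')"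
        using t(2) step_located[OF l1] True by (intro reaches_Suc) simp
      then have 1: "reaches p (a, r, xs) (Suc (Suc t)) (a, r', xs')"
        using reaches_snoc step_located[OF l4] by fastforce
      obtain t' r'' xs'' where t': "t' \<le> (2 + cost c) * (m' + 1)"
        "reaches p (a, r', xs') t' (a + 3 + clen c, r'', xs'')" "\<exists>m. I m r'' xs''" "\<not> r'' i < r'' j"
        using less.IH[OF t(3,4)] by blast
      \<comment> \<open>Since \<open>m' < m\<close>, one summand is left over to pay for the
        iteration just made.\<close>
      have "(2 + cost c) * (m' + 2) \<le> (2 + cost c) * (m + 1)" using t(3) by (intro mult_le_mono2) simp
      then have "Suc (Suc t) + t' \<le> (2 + cost c) * (m + 1)" using t(1) t'(1) by simp
      then show ?thesis using reaches_trans[OF 1 t'(2)] t'(3,4) by blast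
    next
      case False
      have "reaches p (Suc a, r, xs) 1 (a + 3 + clen c, r, xs)"
        using step_located[OF l2] by (simp add: reaches_def)
      then have "reaches p (a, r, xs) 2 (a + 3 + clen c, r, xs)"
        using step_located[OF l1] False by (simp add: reaches_Suc numeral_2_eq_2)
      then show ?thesis using less.prems False by (intro exI[of _ 2]) auto
    qed
  qed
  then obtain t r' xs' where t: "t \<le> (2 + cost c) * (m + 1)"
    "reaches p (a, r, xs) t (a + 3 + clen c, r', xs')" "\<exists>m. I m r' xs'" "\<not> r' i < r' j"
    by blast
  have "(2 + cost c) * (m + 1) \<le> cost (While i j c) * (b + 1)"
    using m(1) by (simp only: cost.simps) (intro mult_le_mono2, simp)
  then have "t \<le> cost (While i j c) * (b + 1)" using t(1) by linarith
  then show "\<exists>t r' xs'. t \<le> cost (While i j c) * (b + 1) \<and>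
      reaches p (a, r, xs) t (a + clen (While i j c), r', xs') \<and> (\<exists>m. I m r' xs') \<and> \<not> r' i < r' j"
    using t by (intro exI[of _ t] exI[of _ r'] exI[of _ xs']) (simp add: add.assoc)
qed

lemma triple_answers:
  assumes "triple b (\<lambda>r ys. r = (\<lambda>_. 0) \<and> ys = xs) c (\<lambda>r _. r 0 = (if y then 1 else 0))"
  shows "answers_within (compile 0 c) xs (cost c * (b + 1)) y"
proof -
  have "located (compile 0 c) 0 (compile 0 c)" by (auto simp: located_def)
  then obtain t r xs' where "t \<le> cost c * (b + 1)"
    "reaches (compile 0 c) (0, \<lambda>_. 0, xs) t (clen c, r, xs')" "r 0 = (if y then 1 else 0)"
    using assms unfolding triple_def by fastforce
  then show ?thesis unfolding answers_within_def
    by (intro exI[of _ t]) (auto simp: reaches_def initial_def halted_def Let_def)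
qed

section \<open>Memory layout and merging of a leaf\<close>

text \<open>Length of a vertex record: a cost for each of the \<open>2 ^ q\<close> index sets, plus
  the degree and the neighbour sum.\<close>

definition width :: "nat \<Rightarrow> nat" where
  "width q = 2 ^ q + 2"

text \<open>Fourteen working registers and three blocks of \<open>2 ^ q\<close> registers precede
  the records.\<close>

definition base :: "nat \<Rightarrow> nat" where
  "base q = 14 + 3 * 2 ^ q"

definition ptr :: "nat \<Rightarrow> nat \<Rightarrow> nat" where
  "ptr q v = base q + width q * v"

definition field :: "nat \<Rightarrow> (nat \<Rightarrow> nat) \<Rightarrow> nat \<Rightarrow> nat \<Rightarrow> nat" where
  "field q r v j = r (ptr q v + j)"

text \<open>The binary code of the index set, shifted past the entries 0 and 1 for degree and
  neighbour sum.\<close>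

definition slot :: "nat set \<Rightarrow> nat" where
  "slot A = 2 + set_encode A"

definition subs :: "nat \<Rightarrow> nat set list" where
  "subs q = map set (subseqs [0..<q])"

lemma set_subs: "set (subs q) = Pow {..<q}"
  by (simp add: subs_def subseqs_powset atLeast0LessThan)

lemma set_encode_less:
  assumes "A \<subseteq> {..<q}"
  shows "set_encode A < 2 ^ q"
proof -
  have "set_encode A \<le> (\<Sum>i<q. 2 ^ i)"
    unfolding set_encode_def using assms by (auto simp: finite_subset intro!: sum_mono2)
  also have "\<dots> < 2 ^ q" by (induction q) auto
  finally show ?thesis .
qed

lemma set_encode_inj:
  assumes "A \<subseteq> {..<q}" "B \<subseteq> {..<q}"
  shows "set_encode A = set_encode B \<longleftrightarrow> A = B"
  using assms by (intro set_encode_eq) (auto intro: finite_subset)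

lemma slot_less_width: "A \<subseteq> {..<q} \<Longrightarrow> slot A < width q"
  using set_encode_less[of A q] by (simp add: slot_def width_def)

lemma slot_inj: "A \<subseteq> {..<q} \<Longrightarrow> B \<subseteq> {..<q} \<Longrightarrow> slot A = slot B \<longleftrightarrow> A = B"
  using set_encode_inj by (simp add: slot_def)

lemma slot_ge: "slot A \<noteq> 0" "slot A \<noteq> Suc 0"
  by (auto simp: slot_def)

lemma small_less_width: "0 < width q" "Suc 0 < width q"
  by (auto simp: width_def)

lemma small_less_base: "i < 14 \<Longrightarrow> i < base q"
  by (simp add: base_def)

lemma base_le_ptr: "base q \<le> ptr q v"
  by (simp add: ptr_def)

lemma ptr_less_iff: "ptr q u < ptr q v \<longleftrightarrow> u < v"
  using small_less_width by (simp add: ptr_def)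

text \<open>Division with remainder by the record length recovers vertex and entry, so records never
  overlap.\<close>

lemma ptr_field_inj:
  assumes "j < width q" "j' < width q"
  shows "ptr q v + j = ptr q v' + j' \<longleftrightarrow> v = v' \<and> j = j'"
proof
  assume "ptr q v + j = ptr q v' + j'"
  then have "width q * v + j = width q * v' + j'" by (simp add: ptr_def)
  then have "(width q * v + j) div width q = (width q * v' + j') div width q"
    "(width q * v + j) mod width q = (width q * v' + j') mod width q" by simp_all
  then show "v = v' \<and> j = j'" using assms by simp
qed simp

lemma field_low: "i < base q \<Longrightarrow> field q (r(i := y)) v j = field q r v j"
  using base_le_ptr[of q v] by (simp add: field_def)

lemma field_update:
  "j < width q \<Longrightarrow> j' < width q \<Longrightarrow>
   field q (r(ptr q v + j := y)) v' j' = (if v' = v \<and> j' = j then y else field q r v' j')"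
  using ptr_field_inj[of j' q j v' v] by (auto simp: field_def)

lemma low_update: "i < base q \<Longrightarrow> (r(ptr q v + j := y)) i = r i"
  using base_le_ptr[of q v] by simp

text \<open>Register 8 is overwritten by every access to a field, whence the side conditions below.\<close>

definition load_field :: "nat \<Rightarrow> nat \<Rightarrow> nat \<Rightarrow> instr list" where
  "load_field d x j = [Const 8 j, Add 8 x 8, Load d 8]"

definition store_field :: "nat \<Rightarrow> nat \<Rightarrow> nat \<Rightarrow> instr list" where
  "store_field x j s = [Const 8 j, Add 8 x 8, Store 8 s]"

lemma run_load_field:
  assumes "r x = ptr q v" "x \<noteq> 8"
  shows "run (load_field d x j) r = r(8 := ptr q v + j, d := field q r v j)"
  using assms base_le_ptr[of q v] small_less_base[of 8 q] by (simp add: load_field_def field_def)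

lemma run_store_field:
  assumes "r x = ptr q v" "x \<noteq> 8" "s \<noteq> 8"
  shows "run (store_field x j s) r = r(8 := ptr q v + j, ptr q v + j := r s)"
  using assms by (simp add: store_field_def)

definition load_fields :: "nat \<Rightarrow> nat set list \<Rightarrow> (nat set \<Rightarrow> nat) \<Rightarrow> instr list" where
  "load_fields x As d = concat (map (\<lambda>A. load_field (d A) x (slot A)) As)"

definition store_fields :: "nat \<Rightarrow> nat set list \<Rightarrow> (nat set \<Rightarrow> nat) \<Rightarrow> instr list" where
  "store_fields x As s = concat (map (\<lambda>A. store_field x (slot A) (s A)) As)"

lemma run_load_fields:
  assumes "r x = ptr q v" "x \<noteq> 8" "x \<notin> d ` set As" "8 \<notin> d ` set As"
    "\<forall>A\<in>set As. d A < base q" "inj_on d (set As)"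
  defines "r' \<equiv> run (load_fields x As d) r"
  shows "field q r' w j = field q r w j"
    and "A \<in> set As \<Longrightarrow> r' (d A) = field q r v (slot A)"
    and "i \<noteq> 8 \<Longrightarrow> i \<notin> d ` set As \<Longrightarrow> r' i = r i"
proof -
  have "(\<forall>w j. field q (run (load_fields x As d) r) w j = field q r w j) \<and>
    (\<forall>A\<in>set As. run (load_fields x As d) r (d A) = field q r v (slot A)) \<and>
    (\<forall>i. i \<noteq> 8 \<longrightarrow> i \<notin> d ` set As \<longrightarrow> run (load_fields x As d) r i = r i)"
    using assms(1-6)
  proof (induction As arbitrary: r)
    case Nil
    then show ?case by (simp add: load_fields_def)
  next
    case (Cons A As)
    define r1 where "r1 = r(8 := ptr q v + slot A, d A := field q r v (slot A))"
    let ?r = r1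
    have 1: "run (load_fields x (A # As) d) r = run (load_fields x As d) ?r"
      using Cons.prems run_load_field[of r x q v] by (simp add: load_fields_def r1_def)
    have 2: "field q ?r = field q r"
      using Cons.prems small_less_base[of 8 q] by (auto simp: r1_def field_low fun_eq_iff)
    have low: "?r i = r i" if "i \<notin> {8, d A}" for i using that by (simp add: r1_def)
    have A: "?r (d A) = field q r v (slot A)" by (simp add: r1_def)
    have "?r x = ptr q v" using Cons.prems low by auto
    moreover have "inj_on d (set As)" using Cons.prems by simp
    ultimately have IH: "\<forall>w j. field q (run (load_fields x As d) ?r) w j = field q ?r w j"
      "\<forall>A\<in>set As. run (load_fields x As d) ?r (d A) = field q ?r v (slot A)"
      "\<forall>i. i \<noteq> 8 \<longrightarrow> i \<notin> d ` set As \<longrightarrow> run (load_fields x As d) ?r i = ?r i"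
      using Cons.IH[of ?r] Cons.prems by simp_all
    \<comment> \<open>\<open>As\<close> may contain \<open>A\<close> again; then the later load
      repeats the value, and otherwise injectivity of \<open>d\<close> protects it.\<close>
    have "run (load_fields x As d) ?r (d A) = field q r v (slot A)"
    proof (cases "A \<in> set As")
      case True
      then show ?thesis using IH(2) 2 by simp
    next
      case False
      then have "d A \<notin> d ` set As" using Cons.prems by (auto simp: inj_on_def)
      then show ?thesis using IH(3) A Cons.prems by auto
    qed
    then show ?case unfolding 1 using IH low 2 by auto
  qed
  then show "field q r' w j = field q r w j"
    "A \<in> set As \<Longrightarrow> r' (d A) = field q r v (slot A)"
    "i \<noteq> 8 \<Longrightarrow> i \<notin> d ` set As \<Longrightarrow> r' i = r i" unfolding r'_def by blast+
qed

text \<open>Several slots may share one source register, as when a record is cleared or a penalty is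
  written. Entries 0 and 1 survive because no slot coincides with them.\<close>

lemma run_store_fields:
  assumes "r x = ptr q v" "x \<noteq> 8" "x < base q"
    "\<forall>A\<in>set As. A \<subseteq> {..<q} \<and> s A < base q \<and> s A \<noteq> 8"
  defines "r' \<equiv> run (store_fields x As s) r"
  shows "j < 2 \<Longrightarrow> field q r' w j = field q r w j"
    and "A \<subseteq> {..<q} \<Longrightarrow> field q r' w (slot A) =
      (if w = v \<and> A \<in> set As then r (s A) else field q r w (slot A))"
    and "i < base q \<Longrightarrow> i \<noteq> 8 \<Longrightarrow> r' i = r i"
proof -
  have "(\<forall>w j. j < 2 \<longrightarrow> field q (run (store_fields x As s) r) w j = field q r w j) \<and>
    (\<forall>w A. A \<subseteq> {..<q} \<longrightarrow> field q (run (store_fields x As s) r) w (slot A) =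
      (if w = v \<and> A \<in> set As then r (s A) else field q r w (slot A))) \<and>
    (\<forall>i. i < base q \<longrightarrow> i \<noteq> 8 \<longrightarrow> run (store_fields x As s) r i = r i)"
    using assms(1-4)
  proof (induction As arbitrary: r)
    case Nil
    then show ?case by (simp add: store_fields_def)
  next
    case (Cons A As)
    define r1 where "r1 = r(8 := ptr q v + slot A, ptr q v + slot A := r (s A))"
    let ?r = r1
    have 1: "run (store_fields x (A # As) s) r = run (store_fields x As s) ?r"
      using Cons.prems run_store_field[of r x q v] by (simp add: store_fields_def r1_def)
    have A: "A \<subseteq> {..<q}" using Cons.prems by simp
    have low: "?r i = r i" if "i < base q" "i \<noteq> 8" for i
      using that low_update[of i q "r(8 := ptr q v + slot A)" v "slot A" "r (s A)"]
      by (simp add: r1_def)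
    have 2: "field q ?r w j = (if w = v \<and> j = slot A then r (s A) else field q r w j)"
      if "j < width q" for w j
      using that slot_less_width[OF A]
      by (simp add: r1_def field_update field_low small_less_base)
    have "?r x = ptr q v" using Cons.prems low by simp
    then have IH: "\<forall>w j. j < 2 \<longrightarrow> field q (run (store_fields x As s) ?r) w j = field q ?r w j"
      "\<forall>w A. A \<subseteq> {..<q} \<longrightarrow> field q (run (store_fields x As s) ?r) w (slot A) =
        (if w = v \<and> A \<in> set As then ?r (s A) else field q ?r w (slot A))"
      "\<forall>i. i < base q \<longrightarrow> i \<noteq> 8 \<longrightarrow> run (store_fields x As s) ?r i = ?r i"
      using Cons.IH[of ?r] Cons.prems by simp_all
    have "field q (run (store_fields x As s) ?r) w j = field q r w j" if "j < 2" for w j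
      using IH(1) that 2[of j w] by (simp add: slot_def width_def)
    moreover have "field q (run (store_fields x As s) ?r) w (slot B) =
        (if w = v \<and> B \<in> set (A # As) then r (s B) else field q r w (slot B))"
      if "B \<subseteq> {..<q}" for w B
      using IH(2) that 2[OF slot_less_width[OF that], of w] slot_inj[OF that A] low[of "s B"] Cons.prems(4)
      by auto
    moreover have "run (store_fields x As s) ?r i = r i" if "i < base q" "i \<noteq> 8" for i
      using IH(3) that low by simp
    ultimately show ?case unfolding 1 by blast
  qed
  then show "j < 2 \<Longrightarrow> field q r' w j = field q r w j"
    "A \<subseteq> {..<q} \<Longrightarrow> field q r' w (slot A) =
      (if w = v \<and> A \<in> set As then r (s A) else field q r w (slot A))"
    "i < base q \<Longrightarrow> i \<noteq> 8 \<Longrightarrow> r' i = r i" unfolding r'_def by blast+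
qed

text \<open>Bookkeeping at \<open>x\<close> for one neighbour gained (\<open>ar = Add\<close>) or
  lost (\<open>ar = Sub\<close>): register 1 holds the constant one, and neighbours are summed as
  addresses.\<close>

definition adjust :: "(nat \<Rightarrow> nat \<Rightarrow> nat \<Rightarrow> instr) \<Rightarrow> nat \<Rightarrow> nat \<Rightarrow> instr list" where
  "adjust ar x y = load_field 9 x 0 @ [ar 9 9 1] @ store_field x 0 9
     @ load_field 9 x 1 @ [ar 9 9 y] @ store_field x 1 9"

lemma run_adjust:
  assumes x: "r x = ptr q v" "x \<notin> {8, 9}" "x < 14" and y: "y \<notin> {8, 9}" "y < 14" and one: "r 1 = 1"
    and ar: "\<And>i j l r. update (ar i j l) r = r(i := g (r j) (r l))"
  defines "r' \<equiv> run (adjust ar x y) r"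
  shows "j < width q \<Longrightarrow> field q r' w j =
      (if w = v \<and> j = 0 then g (field q r v 0) 1
       else if w = v \<and> j = 1 then g (field q r v 1) (r y) else field q r w j)"
    and "i < base q \<Longrightarrow> i \<notin> {8, 9} \<Longrightarrow> r' i = r i"
proof -
  define r1 where "r1 = r(8 := ptr q v, 9 := g (field q r v 0) 1)"
  define r2 where "r2 = r1(ptr q v + 0 := g (field q r v 0) 1)"
  define r3 where "r3 = r2(8 := ptr q v + 1, 9 := g (field q r v 1) (r y))"
  define r4 where "r4 = r3(ptr q v + 1 := g (field q r v 1) (r y))"
  have e1: "run (load_field 9 x 0 @ [ar 9 9 1]) r = r1"
    using x one by (simp add: run_load_field ar r1_def)
  have "r1 x = ptr q v" using x by (simp add: r1_def)
  then have e2: "run (store_field x 0 9) r1 = r2"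
    using x by (simp add: run_store_field r2_def r1_def fun_upd_twist)
  have low2: "r2 i = r i" if "i < base q" "i \<notin> {8, 9}" for i
    using that low_update[of i q r1 v 0] by (simp add: r2_def r1_def)
  have f2: "field q r2 w j = (if w = v \<and> j = 0 then g (field q r v 0) 1 else field q r w j)"
    if "j < width q" for w j
    using that small_less_width(1) unfolding r2_def
    by (simp only: field_update) (simp add: r1_def field_low small_less_base)
  have "r2 x = ptr q v" "r2 y = r y" using low2 x y by (auto simp: small_less_base)
  then have e3: "run (load_field 9 x 1 @ [ar 9 9 y]) r2 = r3"
    using x y f2[of 1 v] small_less_width by (simp add: run_load_field ar r3_def)
  have low3: "r3 i = r i" if "i < base q" "i \<notin> {8, 9}" for i
    using that low2 by (simp add: r3_def)
  have "r3 x = ptr q v" using low3 x by (simp add: small_less_base)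
  then have e4: "run (store_field x 1 9) r3 = r4"
    using x by (simp add: run_store_field r4_def r3_def fun_upd_twist)
  have f4: "field q r4 w j = (if w = v \<and> j = 1 then g (field q r v 1) (r y) else field q r2 w j)"
    if "j < width q" for w j
    using that small_less_width(2) unfolding r4_def One_nat_def
    by (simp only: field_update) (simp add: r3_def field_low small_less_base)
  have r': "r' = r4"
    unfolding r'_def adjust_def using e1 e2 e3 e4 by simp
  show "j < width q \<Longrightarrow> field q r' w j =
      (if w = v \<and> j = 0 then g (field q r v 0) 1
       else if w = v \<and> j = 1 then g (field q r v 1) (r y) else field q r w j)"
    unfolding r' by (simp add: f4 f2)
  show "i < base q \<Longrightarrow> i \<notin> {8, 9} \<Longrightarrow> r' i = r i"
    unfolding r' r4_def using low3 by (subst low_update) auto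
qed

text \<open>For \<open>A \<subseteq> U\<close> only subsets of \<open>U\<close> enter the minimum.
  Registers represent costs of such sets only, so agreement there is all that can be asked of
  them.\<close>

lemma join_cong:
  assumes "\<And>B. B \<subseteq> U \<Longrightarrow> g B = g' B" "\<And>B. B \<subseteq> U \<Longrightarrow> h B = h' B" "A \<subseteq> U"
  shows "join U g h A = join U g' h' A"
proof -
  have "(\<lambda>B. g B + h (A - B)) ` Pow A = (\<lambda>B. g' B + h' (A - B)) ` Pow A"
  proof (intro image_cong refl)
    fix B assume "B \<in> Pow A"
    then have "B \<subseteq> U" "A - B \<subseteq> U" using assms(3) by auto
    then show "g B + h (A - B) = g' B + h' (A - B)" using assms(1,2) by simp
  qed
  then show ?thesis unfolding join_def using assms by simp
qed

section \<open>Evaluating the merge recurrence for all index sets\<close>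

text \<open>Block 0 holds the costs of the parent, block 1 those of the leaf, block 2 the result of \<open>join\<close>.\<close>

definition reg :: "nat \<Rightarrow> nat \<Rightarrow> nat set \<Rightarrow> nat" where
  "reg q b A = 14 + b * 2 ^ q + set_encode A"

lemma reg_less_base:
  assumes "A \<subseteq> {..<q}" "b < 3"
  shows "reg q b A < base q"
proof -
  have "b * 2 ^ q \<le> 2 * 2 ^ q" using assms(2) by (intro mult_le_mono1) simp
  then show ?thesis using set_encode_less[OF assms(1)] unfolding reg_def base_def by linarith
qed

lemma reg_neq: "i < 14 \<Longrightarrow> i \<noteq> reg q b A" "i < 14 \<Longrightarrow> reg q b A \<noteq> i"
  by (auto simp: reg_def)

lemma reg_eq_iff:
  assumes "A \<subseteq> {..<q}" "B \<subseteq> {..<q}"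
  shows "reg q b A = reg q c B \<longleftrightarrow> b = c \<and> A = B"
proof
  assume "reg q b A = reg q c B"
  then have *: "2 ^ q * b + set_encode A = 2 ^ q * c + set_encode B"
    by (simp add: reg_def mult.commute)
  then have "(2 ^ q * b + set_encode A) div 2 ^ q = (2 ^ q * c + set_encode B) div 2 ^ q" by simp
  then have "b = c" using assms by (simp add: set_encode_less)
  then show "b = c \<and> A = B" using * set_encode_inj[OF assms] by simp
qed simp

text \<open>With truncated subtraction, \<open>a - (a - b)\<close> is the minimum of \<open>a\<close> and \<open>b\<close>.\<close>

definition join_keep :: "nat \<Rightarrow> nat set \<Rightarrow> nat set list \<Rightarrow> instr list" where
  "join_keep q A Bs = concat (map (\<lambda>B. [Add 9 (reg q 0 B) (reg q 1 (A - B)),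
     Sub 10 (reg q 2 A) 9, Sub (reg q 2 A) (reg q 2 A) 10]) Bs)"

definition join_at :: "nat \<Rightarrow> nat set \<Rightarrow> instr list" where
  "join_at q A = [Add (reg q 2 A) (reg q 0 A) (reg q 1 {..<q}), Add (reg q 2 A) (reg q 2 A) 1]
     @ join_keep q A (filter (\<lambda>B. B \<subseteq> A) (subs q))"

text \<open>The accumulator lies in block 2 while costs are read from blocks 0 and 1, so all values
  under the minimum are those of the initial state.\<close>

lemma run_join_keep:
  assumes "A \<subseteq> {..<q}" "\<forall>B\<in>set Bs. B \<subseteq> {..<q}"
  shows "run (join_keep q A Bs) r (reg q 2 A) =
      fold min (map (\<lambda>B. r (reg q 0 B) + r (reg q 1 (A - B))) Bs) (r (reg q 2 A))"
    and "i \<notin> {9, 10, reg q 2 A} \<Longrightarrow> run (join_keep q A Bs) r i = r i"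
proof -
  have "run (join_keep q A Bs) r (reg q 2 A) =
      fold min (map (\<lambda>B. r (reg q 0 B) + r (reg q 1 (A - B))) Bs) (r (reg q 2 A)) \<and>
    (\<forall>i. i \<notin> {9, 10, reg q 2 A} \<longrightarrow> run (join_keep q A Bs) r i = r i)"
    using assms(2)
  proof (induction Bs arbitrary: r)
    case Nil
    then show ?case by (simp add: join_keep_def)
  next
    case (Cons B Bs)
    define G where "G = reg q 2 A"
    define c where "c = r (reg q 0 B) + r (reg q 1 (A - B))"
    define r1 where "r1 = r(9 := c, 10 := r G - c, G := r G - (r G - c))"
    have G: "G \<noteq> 9" "G \<noteq> 10" by (auto simp: G_def reg_neq)
    have keep: "r1 (reg q 0 C) = r (reg q 0 C)" "r1 (reg q 1 (A - C)) = r (reg q 1 (A - C))"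
      if "C \<subseteq> {..<q}" for C
    proof -
      have "A - C \<subseteq> {..<q}" using assms(1) by blast
      then show "r1 (reg q 0 C) = r (reg q 0 C)" "r1 (reg q 1 (A - C)) = r (reg q 1 (A - C))"
        using that assms(1) by (auto simp: r1_def G_def reg_eq_iff reg_neq)
    qed
    have 1: "run (join_keep q A (B # Bs)) r = run (join_keep q A Bs) r1"
      using G by (simp add: join_keep_def G_def[symmetric] c_def r1_def)
    have 2: "map (\<lambda>B. r1 (reg q 0 B) + r1 (reg q 1 (A - B))) Bs =
      map (\<lambda>B. r (reg q 0 B) + r (reg q 1 (A - B))) Bs"
      using keep Cons.prems by simp
    have 3: "r1 G = min c (r G)" by (simp add: r1_def min_def)
    have 4: "r1 i = r i" if "i \<notin> {9, 10, G}" for i using that by (simp add: r1_def)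
    have "run (join_keep q A Bs) r1 G = fold min (map (\<lambda>B. r1 (reg q 0 B) + r1 (reg q 1 (A - B))) Bs) (r1 G)"
      "\<forall>i. i \<notin> {9, 10, G} \<longrightarrow> run (join_keep q A Bs) r1 i = r1 i"
      using Cons.IH[of r1] Cons.prems by (simp_all add: G_def)
    then show ?case unfolding 1 G_def[symmetric] 2 3 using 4 by (simp add: c_def)
  qed
  then show "run (join_keep q A Bs) r (reg q 2 A) =
      fold min (map (\<lambda>B. r (reg q 0 B) + r (reg q 1 (A - B))) Bs) (r (reg q 2 A))"
    "i \<notin> {9, 10, reg q 2 A} \<Longrightarrow> run (join_keep q A Bs) r i = r i" by blast+
qed

lemma run_join_at:
  assumes A: "A \<subseteq> {..<q}" and one: "r 1 = 1"
  shows "run (join_at q A) r (reg q 2 A) =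
      join {..<q} (\<lambda>B. r (reg q 0 B)) (\<lambda>B. r (reg q 1 B)) A"
    and "i \<notin> {9, 10, reg q 2 A} \<Longrightarrow> run (join_at q A) r i = r i"
proof -
  let ?Bs = "filter (\<lambda>B. B \<subseteq> A) (subs q)"
  let ?c = "r (reg q 0 A) + r (reg q 1 {..<q}) + 1"
  let ?r = "r(reg q 2 A := ?c)"
  have Bs: "\<forall>B\<in>set ?Bs. B \<subseteq> {..<q}" "set ?Bs = Pow A" using A by (auto simp: set_subs)
  have "run (join_at q A) r = run (join_keep q A ?Bs) ?r"
    using one by (simp add: join_at_def reg_neq)
  note 1 = this
  have maps: "map (\<lambda>B. ?r (reg q 0 B) + ?r (reg q 1 (A - B))) ?Bs =
    map (\<lambda>B. r (reg q 0 B) + r (reg q 1 (A - B))) ?Bs"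
  proof (rule map_cong[OF refl])
    fix B assume "B \<in> set ?Bs"
    then have "B \<subseteq> {..<q}" "A - B \<subseteq> {..<q}" using Bs A by auto
    then show "?r (reg q 0 B) + ?r (reg q 1 (A - B)) = r (reg q 0 B) + r (reg q 1 (A - B))"
      using A by (simp add: reg_eq_iff)
  qed
  then have "run (join_at q A) r (reg q 2 A) =
      fold min (map (\<lambda>B. r (reg q 0 B) + r (reg q 1 (A - B))) ?Bs) ?c"
    unfolding 1 run_join_keep(1)[OF A Bs(1)] maps by simp
  also have "\<dots> = Min (set (?c # map (\<lambda>B. r (reg q 0 B) + r (reg q 1 (A - B))) ?Bs))"
    by (rule Min.set_eq_fold[symmetric])
  also have "\<dots> = join {..<q} (\<lambda>B. r (reg q 0 B)) (\<lambda>B. r (reg q 1 B)) A"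
    unfolding join_def list.set set_map Bs(2) ..
  finally show "run (join_at q A) r (reg q 2 A) =
      join {..<q} (\<lambda>B. r (reg q 0 B)) (\<lambda>B. r (reg q 1 B)) A" .
  show "i \<notin> {9, 10, reg q 2 A} \<Longrightarrow> run (join_at q A) r i = r i"
    unfolding 1 using run_join_keep(2)[OF A Bs(1)] by simp
qed

text \<open>Results get a block of their own: overwriting the parent's costs would spoil entries
  that other index sets still read.\<close>

lemma run_join_all:
  assumes "r 1 = 1" "\<forall>A\<in>set As. A \<subseteq> {..<q}"
  defines "r' \<equiv> run (concat (map (join_at q) As)) r"
  shows "A \<in> set As \<Longrightarrow> r' (reg q 2 A) = join {..<q} (\<lambda>B. r (reg q 0 B)) (\<lambda>B. r (reg q 1 B)) A"
    and "i \<notin> {9, 10} \<Longrightarrow> i \<notin> reg q 2 ` set As \<Longrightarrow> r' i = r i"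
proof -
  have "(\<forall>A\<in>set As. run (concat (map (join_at q) As)) r (reg q 2 A) =
      join {..<q} (\<lambda>B. r (reg q 0 B)) (\<lambda>B. r (reg q 1 B)) A) \<and>
    (\<forall>i. i \<notin> {9, 10} \<longrightarrow> i \<notin> reg q 2 ` set As \<longrightarrow> run (concat (map (join_at q) As)) r i = r i)"
    using assms(1,2)
  \<comment> \<open>Induction from the right keeps \<open>r\<close> as the initial state, whose
    costs the last \<open>join_at\<close> still finds in blocks 0 and 1.\<close>
  proof (induction As rule: rev_induct)
    case (snoc A As)
    let ?r = "run (concat (map (join_at q) As)) r"
    have low: "?r i = r i" if "i \<notin> {9, 10}" "i \<notin> reg q 2 ` set As" for i
      using snoc that by simp
    have A: "A \<subseteq> {..<q}" "\<forall>A\<in>set As. A \<subseteq> {..<q}" using snoc.prems by auto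
    have one: "?r 1 = 1" using low[of 1] snoc.prems reg_neq(1)[of 1] by auto
    have keep: "?r (reg q b B) = r (reg q b B)" if "b < 2" "B \<subseteq> {..<q}" for b B
      using that A(2) by (intro low) (auto simp: reg_eq_iff reg_neq)
    have "join {..<q} (\<lambda>B. ?r (reg q 0 B)) (\<lambda>B. ?r (reg q 1 B)) A =
      join {..<q} (\<lambda>B. r (reg q 0 B)) (\<lambda>B. r (reg q 1 B)) A"
      using keep[of 0] keep[of 1] A(1) by (intro join_cong) auto
    then have new: "run (join_at q A) ?r (reg q 2 A) = join {..<q} (\<lambda>B. r (reg q 0 B)) (\<lambda>B. r (reg q 1 B)) A"
      using run_join_at(1)[of A q ?r] A(1) one by simp
    have old: "run (join_at q A) ?r i = ?r i" if "i \<notin> {9, 10, reg q 2 A}" for i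
      using run_join_at(2)[of A q ?r i] A(1) one that by simp
    have "run (join_at q A) ?r (reg q 2 B) =
        join {..<q} (\<lambda>B. r (reg q 0 B)) (\<lambda>B. r (reg q 1 B)) B" if "B \<in> set (As @ [A])" for B
    proof (cases "B = A")
      case False
      then have "B \<in> set As" using that by simp
      moreover from this have "reg q 2 B \<noteq> reg q 2 A" using False A by (simp add: reg_eq_iff)
      ultimately show ?thesis using old[of "reg q 2 B"] snoc by (simp add: reg_neq)
    qed (use new in simp)
    then show ?case using old low by auto
  qed simp
  then show "A \<in> set As \<Longrightarrow> r' (reg q 2 A) = join {..<q} (\<lambda>B. r (reg q 0 B)) (\<lambda>B. r (reg q 1 B)) A"
    "i \<notin> {9, 10} \<Longrightarrow> i \<notin> reg q 2 ` set As \<Longrightarrow> r' i = r i" unfolding r'_def by blast+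
qed

text \<open>Entry 1 of a leaf is the address of its neighbour, hence the first load. Clearing the
  leaf's record realises its empty neighbourhood and zero cost; the final move continues the climb
  at the parent.\<close>

definition merge :: "nat \<Rightarrow> instr list" where
  "merge q = load_field 7 4 1 @ load_fields 7 (subs q) (reg q 0) @ load_fields 4 (subs q) (reg q 1)
     @ concat (map (join_at q) (subs q))
     @ store_fields 7 (subs q) (reg q 2) @ store_fields 4 (subs q) (\<lambda>_. 0)
     @ store_field 4 0 0 @ store_field 4 1 0 @ adjust Sub 7 4 @ [Move 4 7]"

lemma inj_on_reg: "inj_on (reg q b) (Pow {..<q})"
  by (auto simp: inj_on_def reg_eq_iff)

lemma run_merge:
  assumes u: "r 4 = ptr q u" and p: "field q r u 1 = ptr q p" and up: "u \<noteq> p"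
    and zero: "r 0 = 0" and one: "r 1 = 1"
  defines "r' \<equiv> run (merge q) r"
  shows "field q r' w 0 = (if w = u then 0 else if w = p then field q r p 0 - 1 else field q r w 0)"
    and "field q r' w 1 =
      (if w = u then 0 else if w = p then field q r p 1 - ptr q u else field q r w 1)"
    and "A \<subseteq> {..<q} \<Longrightarrow> field q r' w (slot A) = (if w = u then 0 else if w = p
      then join {..<q} (\<lambda>A. field q r p (slot A)) (\<lambda>A. field q r u (slot A)) A
      else field q r w (slot A))"
    and "r' 4 = ptr q p"
    and "i < 14 \<Longrightarrow> i \<notin> {4, 7, 8, 9, 10} \<Longrightarrow> r' i = r i"
proof -
  let ?S = "subs q"
  \<comment> \<open>One state per piece of code. Below, facts named \<open>f\<close> concern record
    fields, \<open>l\<close> the registers below 14, and \<open>g\<close> the cost blocks.\<close>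
  define r1 where "r1 = run (load_field 7 4 1) r"
  define r2 where "r2 = run (load_fields 7 ?S (reg q 0)) r1"
  define r3 where "r3 = run (load_fields 4 ?S (reg q 1)) r2"
  define r4 where "r4 = run (concat (map (join_at q) ?S)) r3"
  define r5 where "r5 = run (store_fields 7 ?S (reg q 2)) r4"
  define r6 where "r6 = run (store_fields 4 ?S (\<lambda>_. 0)) r5"
  define r7 where "r7 = run (store_field 4 0 0) r6"
  define r8 where "r8 = run (store_field 4 1 0) r7"
  define r9 where "r9 = run (adjust Sub 7 4) r8"
  note less = small_less_base small_less_width
  have r1: "r1 = r(8 := ptr q u + 1, 7 := ptr q p)"
    using run_load_field[of r 4 q u 7 1] u p by (simp add: r1_def)
  have f1: "field q r1 = field q r" by (auto simp: r1 field_low less fun_eq_iff)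
  have l1: "r1 i = r i" if "i < 14" "i \<notin> {7, 8, 9, 10}" for i using that by (simp add: r1)
  have p1: "r1 7 = ptr q p" by (simp add: r1)
  have regs: "x \<notin> reg q b ` set ?S" if "x < 14" for x b
    using that reg_neq by auto
  have regl: "\<forall>A\<in>set ?S. reg q b A < base q" if "b < 3" for b
    using that by (simp add: set_subs reg_less_base)
  have inj: "inj_on (reg q b) (set ?S)" for b by (simp add: set_subs inj_on_reg)
  note load2 = run_load_fields[of r1 7 q p "reg q 0" ?S, folded r2_def, OF p1 _ regs regs regl inj]
  have f2: "field q r2 = field q r" using load2(1) f1 by (auto simp: fun_eq_iff)
  have l2: "r2 i = r1 i" if "i < 14" "i \<notin> {8, 9, 10}" for i
    using that load2(3) regs by simp
  have g2: "r2 (reg q 0 A) = field q r p (slot A)" if "A \<subseteq> {..<q}" for A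
    using load2(2)[of A] that f1 by (simp add: set_subs)
  have u2: "r2 4 = ptr q u" using l2 l1 u by simp
  note load3 = run_load_fields[of r2 4 q u "reg q 1" ?S, folded r3_def, OF u2 _ regs regs regl inj]
  have f3: "field q r3 = field q r" using load3(1) f2 by (auto simp: fun_eq_iff)
  have l3: "r3 i = r1 i" if "i < 14" "i \<notin> {8, 9, 10}" for i
    using that load3(3) regs l2 by simp
  have g3: "r3 (reg q 0 A) = field q r p (slot A)" "r3 (reg q 1 A) = field q r u (slot A)"
    if "A \<subseteq> {..<q}" for A
  proof -
    have "reg q 0 A \<notin> reg q 1 ` set ?S" using that by (auto simp: set_subs reg_eq_iff)
    then show "r3 (reg q 0 A) = field q r p (slot A)"
      using load3(3)[of "reg q 0 A"] g2[OF that] by (simp add: reg_neq)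
    show "r3 (reg q 1 A) = field q r u (slot A)"
      using load3(2)[of A] that f2 by (simp add: set_subs)
  qed
  have one3: "r3 1 = 1" using l3 l1 one by simp
  have sub: "\<forall>A\<in>set ?S. A \<subseteq> {..<q}" by (simp add: set_subs)
  note join4 = run_join_all[of r3 ?S q, folded r4_def, OF one3 sub]
  have f4: "field q r4 w j = field q r w j" for w j
  proof -
    have "base q \<le> ptr q w + j" using base_le_ptr[of q w] by simp
    then have "ptr q w + j \<notin> {9, 10}" "ptr q w + j \<notin> reg q 2 ` set ?S"
      using less(1)[of 9 q] less(1)[of 10 q] regl[of 2] by auto
    then have "r4 (ptr q w + j) = r3 (ptr q w + j)" by (rule join4(2))
    then show ?thesis using f3 by (simp add: field_def fun_eq_iff)
  qed
  have l4: "r4 i = r1 i" if "i < 14" "i \<notin> {8, 9, 10}" for i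
    using that join4(2)[of i] regs l3 by simp
  have g4: "r4 (reg q 2 A) = join {..<q} (\<lambda>A. field q r p (slot A)) (\<lambda>A. field q r u (slot A)) A"
    if "A \<subseteq> {..<q}" for A
    using join4(1)[of A] join_cong[OF g3 that] that by (simp add: set_subs)
  have p4: "r4 7 = ptr q p" using l4 p1 by simp
  have "\<forall>A\<in>set ?S. A \<subseteq> {..<q} \<and> reg q 2 A < base q \<and> reg q 2 A \<noteq> 8"
    using sub regl reg_neq by simp
  note store5 = run_store_fields[of r4 7 q p ?S "reg q 2", folded r5_def, OF p4 _ less(1) this]
  have l5: "r5 i = r1 i" if "i < 14" "i \<notin> {8, 9, 10}" for i
    using that store5(3)[of i] less l4 by simp
  have u5: "r5 4 = ptr q u" using l5 l1 u by simp
  have z5: "\<forall>A\<in>set ?S. A \<subseteq> {..<q} \<and> 0 < base q \<and> (0::nat) \<noteq> 8" using sub less by simp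
  note store6 = run_store_fields[of r5 4 q u ?S "\<lambda>_. 0", folded r6_def, OF u5 _ less(1) z5]
  have l6: "r6 i = r1 i" if "i < 14" "i \<notin> {8, 9, 10}" for i
    using that store6(3)[of i] less l5 by simp
  have zero5: "r5 0 = 0" using l5 l1 zero by simp
  have u6: "r6 4 = ptr q u" and zero6: "r6 0 = 0" using l6 l1 u zero by auto
  have r7: "r7 = r6(8 := ptr q u + 0, ptr q u + 0 := 0)"
    using run_store_field[of r6 4 q u 0 0] u6 zero6 by (simp add: r7_def)
  have l7: "r7 i = r1 i" if "i < 14" "i \<notin> {8, 9, 10}" for i
    using that l6 less unfolding r7 by (subst low_update) auto
  have u7: "r7 4 = ptr q u" and zero7: "r7 0 = 0" using l7 l1 u zero by auto
  have r8: "r8 = r7(8 := ptr q u + 1, ptr q u + 1 := 0)"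
    using run_store_field[of r7 4 q u 0 1] u7 zero7 by (simp add: r8_def)
  have l8: "r8 i = r1 i" if "i < 14" "i \<notin> {8, 9, 10}" for i
    using that l7 less unfolding r8 by (subst low_update) auto
  have f7: "field q r7 w j = (if w = u \<and> j = 0 then 0 else field q r6 w j)" if "j < width q" for w j
    using that less(2) unfolding r7 by (simp only: field_update) (simp add: field_low less)
  have f8: "field q r8 w j = (if w = u \<and> j < 2 then 0 else field q r6 w j)" if "j < width q" for w j
    using that less(3) unfolding r8 One_nat_def
    by (simp only: field_update) (auto simp add: field_low less f7 less_2_cases_iff)
  have p8: "r8 7 = ptr q p" and u8: "r8 4 = ptr q u" and one8: "r8 1 = 1"
    using l8 l1 p1 u one by auto
  note adj = run_adjust[of r8 7 q p 4 Sub "(-)", folded r9_def, OF p8 _ _ _ _ one8]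
  have r': "r' = r9(4 := r9 7)"
    by (simp add: r'_def merge_def r1_def r2_def r3_def r4_def r5_def r6_def r7_def r8_def r9_def)
  have l9: "r9 i = r1 i" if "i < 14" "i \<notin> {8, 9, 10}" for i
    using that adj(2)[of i] less l8 by simp
  have f': "field q r' w j =
      (if w = p \<and> j = 0 then field q r8 p 0 - 1
       else if w = p \<and> j = 1 then field q r8 p 1 - ptr q u else field q r8 w j)"
    if "j < width q" for w j
    using that adj(1)[of j w] u8 unfolding r' by (simp add: field_low less)
  have f6: "field q r6 w j = field q r w j" if "j < 2" for w j
    using that store6(1) store5(1) f4 by simp
  show "field q r' w 0 = (if w = u then 0 else if w = p then field q r p 0 - 1 else field q r w 0)"
    using f'[of 0 w] f8[of 0] f6[of 0] less up by auto
  show "field q r' w 1 =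
      (if w = u then 0 else if w = p then field q r p 1 - ptr q u else field q r w 1)"
    using f'[of 1 w] f8[of 1] f6[of 1] less up by auto
  show "field q r' w (slot A) = (if w = u then 0 else if w = p
      then join {..<q} (\<lambda>A. field q r p (slot A)) (\<lambda>A. field q r u (slot A)) A
      else field q r w (slot A))" if A: "A \<subseteq> {..<q}"
  proof -
    have "field q r' w (slot A) = field q r6 w (slot A)"
      using f'[OF slot_less_width[OF A], of w] f8[OF slot_less_width[OF A], of w] slot_ge[of A]
      by (simp add: slot_def)
    also have "\<dots> = (if w = u then 0 else field q r5 w (slot A))"
      using store6(2)[OF _ _ A, of w] zero5 A by (simp add: set_subs)
    finally show ?thesis using store5(2)[OF _ _ A, of w] g4[OF A] f4 A up by (auto simp: set_subs)
  qed
  show "r' 4 = ptr q p" using l9 p1 by (simp add: r')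
  show "i < 14 \<Longrightarrow> i \<notin> {4, 7, 8, 9, 10} \<Longrightarrow> r' i = r i"
    using l9 l1 by (simp add: r')
qed

section \<open>Memory as a representation of the residual problem\<close>

text \<open>Vertices are represented by the addresses of their records. A record consists of the degree,
  the sum of the neighbours, which is the only neighbour if the degree is one, and the costs.\<close>

definition heap ::
    "nat \<Rightarrow> nat \<Rightarrow> nat set set \<Rightarrow> (nat \<Rightarrow> nat set \<Rightarrow> nat) \<Rightarrow> (nat \<Rightarrow> nat) \<Rightarrow> bool" where
  "heap q n E f r \<longleftrightarrow> (\<forall>v<n. field q r v 0 = card (nbrs E v)
     \<and> field q r v 1 = (\<Sum>w\<in>nbrs E v. ptr q w)
     \<and> (\<forall>A. A \<subseteq> {..<q} \<longrightarrow> field q r v (slot A) = f v A))"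

lemma heap_merge:
  assumes H: "heap q n E f r" and G: "simple_graph {..<n} E" and leaf: "nbrs E u = {p}"
    and r: "r 4 = ptr q u" "r 0 = 0" "r 1 = 1"
  defines "r' \<equiv> run (merge q) r"
  shows "heap q n (E - {{u, p}}) (f(u := \<lambda>_. 0, p := join {..<q} (f p) (f u))) r'"
    and "r' 4 = ptr q p"
    and "i < 14 \<Longrightarrow> i \<notin> {4, 7, 8, 9, 10} \<Longrightarrow> r' i = r i"
proof -
  have "{u, p} \<in> E" using leaf by (auto simp: nbrs_def)
  then have up: "u < n" "p < n" "u \<noteq> p" using simple_graph_edgeD[OF G] by auto
  have "field q r u 1 = ptr q p" using H up leaf by (simp add: heap_def)
  note M = run_merge[OF r(1) this up(3) r(2,3), folded r'_def]
  \<comment> \<open>As \<open>u\<close> is counted at \<open>p\<close>, the truncated subtractions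
    on degree and sum are exact.\<close>
  have "u \<in> nbrs E p" using leaf by (auto simp: nbrs_def insert_commute)
  then have p: "card (nbrs E p - {u}) = card (nbrs E p) - 1"
    "(\<Sum>w\<in>nbrs E p - {u}. ptr q w) = (\<Sum>w\<in>nbrs E p. ptr q w) - ptr q u"
    using finite_nbrs[OF G] by (auto simp: sum_diff1_nat)
  have fields: "field q r v 0 = card (nbrs E v)" "field q r v 1 = (\<Sum>w\<in>nbrs E v. ptr q w)"
    "A \<subseteq> {..<q} \<Longrightarrow> field q r v (slot A) = f v A" if "v < n" for v A
    using H that by (auto simp: heap_def)
  have j: "join {..<q} (\<lambda>A. field q r p (slot A)) (\<lambda>A. field q r u (slot A)) A =
    join {..<q} (f p) (f u) A" if "A \<subseteq> {..<q}" for A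
    using that fields up by (intro join_cong) auto
  show "heap q n (E - {{u, p}}) (f(u := \<lambda>_. 0, p := join {..<q} (f p) (f u))) r'"
    unfolding heap_def
  proof (intro allI impI conjI)
    fix v assume v: "v < n"
    show "field q r' v 0 = card (nbrs (E - {{u, p}}) v)"
      unfolding M(1) nbrs_delete[OF up(3)] using fields[OF v] fields[OF up(2)] p leaf by auto
    show "field q r' v 1 = (\<Sum>w\<in>nbrs (E - {{u, p}}) v. ptr q w)"
      unfolding M(2) nbrs_delete[OF up(3)] using fields[OF v] fields[OF up(2)] p leaf by auto
    show "field q r' v (slot A) = (f(u := \<lambda>_. 0, p := join {..<q} (f p) (f u))) v A"
      if "A \<subseteq> {..<q}" for A
      unfolding M(3)[OF that] using fields[OF v] j that up(3) by auto
  qed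
  show "r' 4 = ptr q p" "i < 14 \<Longrightarrow> i \<notin> {4, 7, 8, 9, 10} \<Longrightarrow> r' i = r i"
    using M(4,5) by blast+
qed

text \<open>A new edge adds a fresh neighbour at both ends; an edge already present would be counted
  twice in degree and sum.\<close>

lemma heap_link:
  assumes H: "heap q n E f r" and G: "simple_graph {..<n} (insert {u, v} E)" and new: "{u, v} \<notin> E"
    and r: "r 4 = ptr q u" "r 5 = ptr q v" "r 1 = 1"
  defines "r' \<equiv> run (adjust Add 4 5 @ adjust Add 5 4) r"
  shows "heap q n (insert {u, v} E) f r'"
    and "i < 14 \<Longrightarrow> i \<notin> {8, 9} \<Longrightarrow> r' i = r i"
proof -
  have uv: "u < n" "v < n" "u \<noteq> v" using simple_graph_edgeD[OF G] by auto
  define r1 where "r1 = run (adjust Add 4 5) r"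
  note A1 = run_adjust[of r 4 q u 5 Add "(+)", folded r1_def, OF r(1) _ _ _ _ r(3)]
  have l1: "r1 i = r i" if "i < 14" "i \<notin> {8, 9}" for i
    using that A1(2)[of i] small_less_base by simp
  have r1: "r1 4 = ptr q u" "r1 5 = ptr q v" "r1 1 = 1" using l1 r by auto
  have r': "r' = run (adjust Add 5 4) r1" by (simp add: r'_def r1_def)
  note A2 = run_adjust[of r1 5 q v 4 Add "(+)", folded r', OF r1(2) _ _ _ _ r1(3)]
  have nb: "v \<notin> nbrs E u" "u \<notin> nbrs E v" using new by (auto simp: nbrs_def insert_commute)
  have fin: "finite (nbrs E w)" for w
    using finite_nbrs[OF simple_graph_mono[OF G]] by blast
  have fields: "field q r v 0 = card (nbrs E v)" "field q r v 1 = (\<Sum>w\<in>nbrs E v. ptr q w)"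
    "A \<subseteq> {..<q} \<Longrightarrow> field q r v (slot A) = f v A" if "v < n" for v A
    using H that by (auto simp: heap_def)
  show "heap q n (insert {u, v} E) f r'"
    unfolding heap_def
  proof (intro allI impI conjI)
    fix w assume w: "w < n"
    show "field q r' w 0 = card (nbrs (insert {u, v} E) w)"
      unfolding nbrs_insert[OF uv(3)]
      using A2(1)[of 0 w] A1(1)[of 0] fields[OF w] uv(3) small_less_width nb fin by auto
    show "field q r' w 1 = (\<Sum>x\<in>nbrs (insert {u, v} E) w. ptr q x)"
      unfolding nbrs_insert[OF uv(3)]
      using A2(1)[of 1 w] A1(1)[of 1] fields[OF w] uv(3) small_less_width nb fin r r1 by auto
    show "field q r' w (slot A) = f w A" if "A \<subseteq> {..<q}" for A
      using A2(1)[OF _ _ _ _ _ slot_less_width[OF that], of w]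
        A1(1)[OF _ _ _ _ _ slot_less_width[OF that], of w] slot_ge[of A] fields[OF w] that
      by simp
  qed
  show "i < 14 \<Longrightarrow> i \<notin> {8, 9} \<Longrightarrow> r' i = r i"
    using A2(2)[of i] l1 small_less_base by simp
qed

lemma ptr_0: "ptr q 0 = base q"
  by (simp add: ptr_def)

lemma ptr_Suc: "ptr q (Suc v) = ptr q v + width q"
  by (simp add: ptr_def)

text \<open>Repeated addition replaces the missing multiplication; the number of additions depends
  on \<open>q\<close> only.\<close>

definition goto_vertex :: "nat \<Rightarrow> nat \<Rightarrow> nat \<Rightarrow> instr list" where
  "goto_vertex q d s = Const d (base q) # replicate (width q) (Add d d s)"

lemma run_goto_vertex:
  assumes "d \<noteq> s"
  shows "run (goto_vertex q d s) r = r(d := ptr q (r s))"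
proof -
  have "run (replicate m (Add d d s)) r = r(d := r d + m * r s)" for m r
    using assms by (induction m arbitrary: r) (auto simp: fun_eq_iff)
  then show ?thesis using assms by (simp add: goto_vertex_def ptr_def)
qed

lemma plain_code [simp]:
  "i \<in> set (goto_vertex q d s) \<Longrightarrow> plain i"
  "i \<in> set (load_field d x j) \<Longrightarrow> plain i"
  "i \<in> set (store_fields x As src) \<Longrightarrow> plain i"
  "i \<in> set (adjust Add x y) \<Longrightarrow> plain i"
  "i \<in> set (merge q) \<Longrightarrow> plain i"
  by (auto simp: goto_vertex_def load_field_def store_field_def store_fields_def load_fields_def
      adjust_def merge_def join_at_def join_keep_def)

text \<open>Constants kept throughout: register 2 is both the penalty and the acceptance threshold,
  register 6 the address just past the last record, register 12 the distance between
  records.\<close>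

definition env :: "nat \<Rightarrow> nat \<Rightarrow> nat \<Rightarrow> (nat \<Rightarrow> nat) \<Rightarrow> bool" where
  "env q n k r \<longleftrightarrow> r 0 = 0 \<and> r 1 = 1 \<and> r 2 = Suc k \<and> r 6 = ptr q n \<and> r 12 = width q"

lemma env_cong:
  "env q n k r \<Longrightarrow> (\<And>i. i \<in> {0, 1, 2, 6, 12} \<Longrightarrow> r' i = r i) \<Longrightarrow> env q n k r'"
  by (simp add: env_def)

lemma heap_low:
  assumes "heap q n E f r" "i < 14"
  shows "heap q n E f (r(i := y))"
  using assms by (simp add: heap_def field_low small_less_base)

lemma heap_cong:
  "heap q n E f r \<Longrightarrow> (\<And>x A. x < n \<Longrightarrow> A \<subseteq> {..<q} \<Longrightarrow> f x A = g x A) \<Longrightarrow> heap q n E g r"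
  by (simp add: heap_def)

section \<open>Reading the input\<close>

definition read_header :: "nat \<Rightarrow> com" where
  "read_header q = Seq (Input 9) (Seq (Do (Const 1 1 # Const 12 (width q) # goto_vertex q 6 9))
     (Seq (Input 2) (Seq (Do [Add 2 2 1]) (Input 3))))"

lemma triple_read_header:
  "triple b (\<lambda>r xs. r = (\<lambda>_. 0) \<and> xs = n # k # m # ys) (read_header q)
     (\<lambda>r xs. env q n k r \<and> heap q n {} (\<lambda>_ _. 0) r \<and> r 3 = m \<and> xs = ys)"
  unfolding read_header_def
proof (rule triple_conseq[OF triple_Seq[OF triple_Input triple_Seq[OF triple_Do
        triple_Seq[OF triple_Input triple_Seq[OF triple_Do triple_Input]]]]])
  fix r :: "nat \<Rightarrow> nat" and xs assume *: "r = (\<lambda>_. 0) \<and> xs = n # k # m # ys"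
  \<comment> \<open>The all-zero memory already describes the edgeless graph with zero costs, so
    nothing has to be initialised vertex by vertex.\<close>
  have "heap q n {} (\<lambda>_ _. 0) (\<lambda>_. 0)" by (simp add: heap_def field_def nbrs_def)
  then show "xs \<noteq> [] \<and> tl xs \<noteq> [] \<and> tl (tl xs) \<noteq> [] \<and>
      (\<lambda>r xs. env q n k r \<and> heap q n {} (\<lambda>_ _. 0) r \<and> r 3 = m \<and> xs = ys)
       ((run [Add 2 2 1] ((run (Const 1 1 # Const 12 (width q) # goto_vertex q 6 9)
           (r(9 := hd xs)))(2 := hd (tl xs))))(3 := hd (tl (tl xs)))) (tl (tl (tl xs)))"
    using * by (simp add: run_goto_vertex env_def heap_low)
qed auto

definition read_edges :: "nat \<Rightarrow> com" where
  "read_edges q = While 0 3 (Seq (Input 10) (Seq (Input 11)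
     (Do (goto_vertex q 4 10 @ goto_vertex q 5 11
       @ (adjust Add 4 5 @ adjust Add 5 4) @ [Sub 3 3 1]))))"

lemma triple_read_edges:
  fixes es :: "(nat \<times> nat) list"
  defines "edges \<equiv> \<lambda>es. set (map (\<lambda>(u, v). {u, v}) es)"
    and "word \<equiv> \<lambda>es. concat (map (\<lambda>(u, v). [u, v]) es)"
  assumes G: "simple_graph {..<n} (edges es)"
    and dist: "distinct (map (\<lambda>(u, v). {u, v}) es)" and b: "length es \<le> b"
  shows "triple b (\<lambda>r xs. env q n k r \<and> heap q n {} f r \<and> r 3 = length es \<and> xs = word es @ ys)
    (read_edges q) (\<lambda>r xs. env q n k r \<and> heap q n (edges es) f r \<and> xs = ys)"
proof -
  \<comment> \<open>\<open>es1\<close> has been linked and \<open>es2\<close> is unread; its length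
    is both the counter in register 3 and the measure.\<close>
  define I where "I m r xs \<longleftrightarrow> (\<exists>es1 es2. es = es1 @ es2 \<and> m = length es2 \<and> r 3 = m \<and>
    xs = word es2 @ ys \<and> env q n k r \<and> heap q n (edges es1) f r)" for m r xs
  have body: "triple 0 (\<lambda>r xs. I m r xs \<and> r 0 < r 3) (Seq (Input 10) (Seq (Input 11)
     (Do (goto_vertex q 4 10 @ goto_vertex q 5 11
       @ (adjust Add 4 5 @ adjust Add 5 4) @ [Sub 3 3 1])))) (\<lambda>r xs. \<exists>m'<m. I m' r xs)" for m
  proof (rule triple_conseq[OF triple_Seq[OF triple_Input triple_Seq[OF triple_Input triple_Do]]])
    fix r xs assume "I m r xs \<and> r 0 < r 3"
    then obtain es1 u v es2 where es: "es = es1 @ (u, v) # es2" "m = Suc (length es2)" "r 3 = m"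
      "xs = u # v # word es2 @ ys" and E: "env q n k r" and H: "heap q n (edges es1) f r"
      unfolding I_def env_def word_def by (auto simp: neq_Nil_conv)
    let ?r1 = "r(10 := u, 11 := v, 4 := ptr q u, 5 := ptr q v)"
    let ?r = "run (goto_vertex q 4 10 @ goto_vertex q 5 11
       @ (adjust Add 4 5 @ adjust Add 5 4) @ [Sub 3 3 1]) (r(10 := u, 11 := v))"
    have e: "edges (es1 @ [(u, v)]) = insert {u, v} (edges es1)" by (auto simp: edges_def)
    have G': "simple_graph {..<n} (insert {u, v} (edges es1))"
      using G by (rule simple_graph_mono) (auto simp: edges_def es)
    have new: "{u, v} \<notin> edges es1" using dist by (auto simp: edges_def es)
    have H1: "heap q n (edges es1) f ?r1" using H by (simp add: heap_low)
    define r2 where "r2 = run (adjust Add 4 5 @ adjust Add 5 4) ?r1"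
    have "?r1 1 = 1" using E by (simp add: env_def)
    then have 2: "heap q n (insert {u, v} (edges es1)) f r2"
      "i < 14 \<Longrightarrow> i \<notin> {8, 9} \<Longrightarrow> r2 i = ?r1 i" for i
      using heap_link[OF H1 G' new] unfolding r2_def by simp_all
    have r: "?r = r2(3 := r2 3 - r2 1)"
      by (simp add: run_goto_vertex r2_def)
    have "?r 3 = length es2" unfolding r using 2(2) es E by (simp add: env_def)
    moreover have "env q n k ?r" unfolding r using E by (rule env_cong) (use 2(2) in auto)
    moreover have "heap q n (edges (es1 @ [(u, v)])) f ?r"
      unfolding r e using 2(1) by (simp add: heap_low)
    ultimately have "I (length es2) ?r (word es2 @ ys)"
      unfolding I_def using es by (intro exI[of _ "es1 @ [(u, v)]"] exI[of _ es2]) simp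
    then show "xs \<noteq> [] \<and> tl xs \<noteq> [] \<and> (\<lambda>r xs. \<exists>m'<m. I m' r xs)
      (run (goto_vertex q 4 10 @ goto_vertex q 5 11
       @ (adjust Add 4 5 @ adjust Add 5 4) @ [Sub 3 3 1]) (r(10 := hd xs, 11 := hd (tl xs)))) (tl (tl xs))"
      using es by auto
  qed auto
  show ?thesis unfolding read_edges_def
  proof (rule triple_conseq[OF triple_While[of I, OF body]])
    show "\<exists>m\<le>b. I m r xs"
      if "env q n k r \<and> heap q n {} f r \<and> r 3 = length es \<and> xs = word es @ ys" for r xs
      using that b unfolding I_def
      by (intro exI[of _ "length es"] conjI exI[of _ "[]"] exI[of _ es]) (auto simp: edges_def)
    show "env q n k r \<and> heap q n (edges es) f r \<and> xs = ys"
      if "(\<exists>m. I m r xs) \<and> \<not> r 0 < r 3" for r xs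
      using that by (auto simp: I_def env_def word_def)
  qed
qed

definition read_terminal_set :: "nat \<Rightarrow> nat \<Rightarrow> com" where
  "read_terminal_set q i = While 0 3 (Seq (Input 10) (Do (goto_vertex q 4 10
     @ store_fields 4 (filter (\<lambda>A. i \<notin> A) (subs q)) (\<lambda>_. 2) @ [Sub 3 3 1])))"

text \<open>The penalty overwrites an entry instead of being added to it, so a vertex in several
  terminal sets is charged \<open>Suc k\<close> once, as in \<open>terminal_cost\<close>.\<close>

lemma triple_read_terminal_set:
  assumes s: "set s \<subseteq> {..<n}" and b: "length s \<le> b"
  shows "triple b (\<lambda>r xs. env q n k r \<and> heap q n E f r \<and> r 3 = length s \<and> xs = s @ ys)
    (read_terminal_set q i) (\<lambda>r xs. env q n k r \<and>
      heap q n E (\<lambda>x A. if x \<in> set s \<and> i \<notin> A then Suc k else f x A) r \<and> xs = ys)"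
proof -
  let ?As = "filter (\<lambda>A. i \<notin> A) (subs q)"
  let ?code = "goto_vertex q 4 10 @ store_fields 4 ?As (\<lambda>_. 2) @ [Sub 3 3 1]"
  let ?f = "\<lambda>s x A. if x \<in> set s \<and> i \<notin> A then Suc k else f x A"
  define I where "I m r xs \<longleftrightarrow> (\<exists>s1 s2. s = s1 @ s2 \<and> m = length s2 \<and> r 3 = m \<and>
    xs = s2 @ ys \<and> env q n k r \<and> heap q n E (?f s1) r)" for m r xs
  have body: "triple 0 (\<lambda>r xs. I m r xs \<and> r 0 < r 3) (Seq (Input 10) (Do ?code))
    (\<lambda>r xs. \<exists>m'<m. I m' r xs)" for m
  proof (rule triple_conseq[OF triple_Seq[OF triple_Input triple_Do]])
    fix r xs assume "I m r xs \<and> r 0 < r 3"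
    then obtain s1 v s2 where s12: "s = s1 @ v # s2" "m = Suc (length s2)" "r 3 = m"
      "xs = v # s2 @ ys" and E: "env q n k r" and H: "heap q n E (?f s1) r"
      unfolding I_def env_def by (auto simp: neq_Nil_conv)
    let ?r1 = "r(10 := v, 4 := ptr q v)"
    define r2 where "r2 = run (store_fields 4 ?As (\<lambda>_. 2)) ?r1"
    have As: "\<forall>A\<in>set ?As. A \<subseteq> {..<q} \<and> 2 < base q \<and> (2::nat) \<noteq> 8"
      by (simp add: set_subs small_less_base)
    have 2: "j < 2 \<Longrightarrow> field q r2 w j = field q ?r1 w j"
      "A \<subseteq> {..<q} \<Longrightarrow> field q r2 w (slot A) =
        (if w = v \<and> A \<in> set ?As then ?r1 2 else field q ?r1 w (slot A))"
      "j < base q \<Longrightarrow> j \<noteq> 8 \<Longrightarrow> r2 j = ?r1 j" for w j A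
      using run_store_fields[of ?r1 4 q v ?As "\<lambda>_. 2", folded r2_def, OF _ _ small_less_base As]
      by simp_all
    have low: "r2 j = ?r1 j" if "j < 14" "j \<noteq> 8" for j
      using 2(3) that small_less_base by blast
    have H1: "heap q n E (?f s1) ?r1" using H by (simp add: heap_low)
    have H2: "heap q n E (?f (s1 @ [v])) r2"
      unfolding heap_def
    proof (intro allI impI conjI)
      fix w assume w: "w < n"
      show "field q r2 w 0 = card (nbrs E w)" "field q r2 w 1 = (\<Sum>w\<in>nbrs E w. ptr q w)"
        using H1 w 2(1) by (simp_all add: heap_def)
      show "field q r2 w (slot A) = ?f (s1 @ [v]) w A" if "A \<subseteq> {..<q}" for A
      proof -
        have "r 2 = Suc k" using E by (simp add: env_def)
        then show ?thesis using H1 w that unfolding 2(2)[OF that] by (auto simp: heap_def set_subs)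
      qed
    qed
    have r: "run ?code (r(10 := v)) = r2(3 := r2 3 - r2 1)"
      by (simp add: run_goto_vertex r2_def)
    have "(r2(3 := r2 3 - r2 1)) 3 = length s2" using low s12 E by (simp add: env_def)
    moreover have "env q n k (r2(3 := r2 3 - r2 1))" using E by (rule env_cong) (use low in auto)
    moreover have "heap q n E (?f (s1 @ [v])) (r2(3 := r2 3 - r2 1))" using H2 by (rule heap_low) simp
    ultimately have "I (length s2) (run ?code (r(10 := v))) (s2 @ ys)"
      unfolding I_def r using s12 by (intro exI[of _ "s1 @ [v]"] exI[of _ s2] conjI) simp_all
    then show "xs \<noteq> [] \<and> (\<lambda>r xs. \<exists>m'<m. I m' r xs) (run ?code (r(10 := hd xs))) (tl xs)"
      using s12 by auto
  qed auto
  show ?thesis unfolding read_terminal_set_def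
  proof (rule triple_conseq[OF triple_While[of I, OF body]])
    show "\<exists>m\<le>b. I m r xs"
      if "env q n k r \<and> heap q n E f r \<and> r 3 = length s \<and> xs = s @ ys" for r xs
      using that b unfolding I_def
      by (intro exI[of _ "length s"] conjI exI[of _ "[]"] exI[of _ s]) auto
    show "env q n k r \<and> heap q n E (?f s) r \<and> xs = ys"
      if "(\<exists>m. I m r xs) \<and> \<not> r 0 < r 3" for r xs
      using that by (auto simp: I_def env_def)
  qed
qed

text \<open>One loop per terminal set, written out in sequence: this avoids nested loops and fixes
  the index \<open>i\<close>, and hence the penalised slots, in the code.\<close>

primrec read_terminals :: "nat \<Rightarrow> nat \<Rightarrow> com" where
  "read_terminals q 0 = Do []"
| "read_terminals q (Suc i) = Seq (read_terminals q i) (Seq (Input 3) (read_terminal_set q i))"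

lemma triple_read_terminals:
  assumes "\<forall>s\<in>set ss. set s \<subseteq> {..<n} \<and> length s \<le> b" "i \<le> length ss"
  shows "triple b (\<lambda>r xs. env q n k r \<and> heap q n E (\<lambda>_ _. 0) r
      \<and> xs = concat (map (\<lambda>s. length s # s) ss)) (read_terminals q i)
    (\<lambda>r xs. env q n k r \<and> heap q n E (terminal_cost (map set (take i ss)) k) r
      \<and> xs = concat (map (\<lambda>s. length s # s) (drop i ss)))"
  using assms(2)
proof (induction i)
  case 0
  have "terminal_cost [] k = (\<lambda>(_::nat) _. 0)" by (auto simp: terminal_cost_def fun_eq_iff)
  then show ?case unfolding read_terminals.simps
    by (intro triple_conseq[OF triple_Do]) auto
next
  case (Suc i)
  let ?f = "\<lambda>i. terminal_cost (map set (take i ss)) k"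
  let ?w = "\<lambda>i. concat (map (\<lambda>s. length s # s) (drop i ss))"
  have i: "i < length ss" using Suc.prems by simp
  have s: "set (ss ! i) \<subseteq> {..<n}" "length (ss ! i) \<le> b" using assms(1) i by auto
  have w: "?w i = length (ss ! i) # ss ! i @ ?w (Suc i)"
    using i by (simp add: Cons_nth_drop_Suc[symmetric])
  have f: "?f (Suc i) x A = (if x \<in> set (ss ! i) \<and> i \<notin> A then Suc k else ?f i x A)" for x A
  proof -
    have "(\<exists>j<Suc i. x \<in> set (ss ! j) \<and> j \<notin> A) \<longleftrightarrow>
      (x \<in> set (ss ! i) \<and> i \<notin> A) \<or> (\<exists>j<i. x \<in> set (ss ! j) \<and> j \<notin> A)"
      by (auto simp: less_Suc_eq)
    then show ?thesis using i unfolding terminal_cost_def by (auto simp: min_def)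
  qed
  have "triple b (\<lambda>r xs. env q n k r \<and> heap q n E (?f i) r \<and> xs = ?w i)
    (Seq (Input 3) (read_terminal_set q i))
    (\<lambda>r xs. env q n k r \<and> heap q n E (?f (Suc i)) r \<and> xs = ?w (Suc i))"
  proof (rule triple_conseq[OF triple_Seq[OF triple_Input triple_read_terminal_set[OF s]]])
    fix r xs assume "env q n k r \<and> heap q n E (?f i) r \<and> xs = ?w i"
    then show "xs \<noteq> [] \<and> env q n k (r(3 := hd xs)) \<and> heap q n E (?f i) (r(3 := hd xs)) \<and>
      (r(3 := hd xs)) 3 = length (ss ! i) \<and> tl xs = ss ! i @ ?w (Suc i)"
      unfolding w by (simp add: heap_low env_def)
  next
    fix r xs assume "env q n k r \<and> heap q n E (\<lambda>x A. if x \<in> set (ss ! i) \<and> i \<notin> A then Suc k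
      else ?f i x A) r \<and> xs = ?w (Suc i)"
    then show "env q n k r \<and> heap q n E (?f (Suc i)) r \<and> xs = ?w (Suc i)"
      using f by (auto intro: heap_cong simp del: concat.simps)
  qed
  then show ?case using Suc by (auto intro: triple_Seq)
qed

section \<open>Stripping the leaves\<close>

text \<open>Register 5 runs through all vertices. From each of them, register 4 climbs up the tree
  as long as it finds leaves, so that no vertex passed by register 5 is left a leaf.\<close>

definition strip :: "nat \<Rightarrow> com" where
  "strip q = While 5 6 (Seq (Do (load_field 9 4 0 @ [Sub 10 9 1, Sub 11 1 9, Add 10 10 11]))
     (If 10 1 (Do (merge q)) (Do [Add 5 5 12, Move 4 5])))"

text \<open>Every iteration removes an edge or advances the scan, so remaining edges plus unscanned
  vertices decrease. At the end no vertex is a leaf, and an acyclic graph without leaves has no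
  edges.\<close>

lemma triple_strip:
  assumes G: "simple_graph {..<n} E" and ac: "\<nexists>c. is_cycle {..<n} E c"
    and b: "card E + n \<le> b" and f: "\<forall>x. antitone_cost {..<q} (f x)"
  shows "triple b (\<lambda>r xs. env q n k r \<and> heap q n E f r \<and> r 4 = ptr q 0 \<and> r 5 = ptr q 0) (strip q)
    (\<lambda>r xs. env q n k r \<and> (\<exists>g. heap q n {} g r \<and>
       (feasible {..<q} {..<n} E f k \<longleftrightarrow> (\<Sum>x<n. g x {..<q}) \<le> k)))"
proof -
  let ?F = "\<lambda>E f. feasible {..<q} {..<n} E f k"
  \<comment> \<open>\<open>u\<close> is the current vertex of the climb and \<open>v\<close> that of
    the scan; among the vertices up to \<open>v\<close> only \<open>u\<close> may be a leaf. Both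
    take the value \<open>n\<close> together, one past the last vertex.\<close>
  define J where "J m r E' g u v \<longleftrightarrow> E' \<subseteq> E \<and> heap q n E' g r \<and> env q n k r \<and>
    (\<forall>x. antitone_cost {..<q} (g x)) \<and> (?F E f \<longleftrightarrow> ?F E' g) \<and> r 4 = ptr q u \<and> r 5 = ptr q v \<and>
    (u < n \<and> v < n \<or> u = n \<and> v = n) \<and> (\<forall>w<n. w \<le> v \<longrightarrow> w \<noteq> u \<longrightarrow> card (nbrs E' w) \<noteq> 1) \<and>
    m = card E' + (n - v)" for m r E' g u v
  define I where "I m r (xs :: nat list) \<longleftrightarrow> (\<exists>E' g u v. J m r E' g u v)" for m r xs
  \<comment> \<open>The sum of the two truncated differences is the distance of the degree from one,
    so register 10 is below one exactly at a leaf.\<close>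
  let ?test = "load_field 9 4 0 @ [Sub 10 9 1, Sub 11 1 9, Add 10 10 11]"
  define K where "K m r (xs :: nat list) \<longleftrightarrow> (\<exists>E' g u v. J m r E' g u v \<and> u < n \<and> v < n \<and>
    (r 10 < r 1 \<longleftrightarrow> card (nbrs E' u) = 1))" for m r xs
  have test: "triple 0 (\<lambda>r xs. I m r xs \<and> r 5 < r 6) (Do ?test) (K m)" for m
  proof (rule triple_conseq[OF triple_Do])
    fix r and xs :: "nat list" assume "I m r xs \<and> r 5 < r 6"
    then obtain E' g u v where J: "J m r E' g u v" and "r 5 < r 6" unfolding I_def by blast
    then have uv: "u < n" "v < n" by (auto simp: J_def env_def ptr_less_iff)
    let ?d = "card (nbrs E' u)"
    have d: "field q r u 0 = ?d" using J uv by (simp add: J_def heap_def)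
    have "run (load_field 9 4 0) r = r(8 := ptr q u, 9 := ?d)"
      using J run_load_field[of r 4 q u 9 0] d by (simp add: J_def)
    moreover have "r 1 = 1" using J by (simp add: J_def env_def)
    ultimately have r: "run ?test r =
        r(8 := ptr q u, 9 := ?d, 10 := ?d - 1, 11 := 1 - ?d, 10 := ?d - 1 + (1 - ?d))"
      by simp
    have "J m (run ?test r) E' g u v"
      unfolding r using J by (simp add: J_def heap_low env_def)
    moreover have "run ?test r 10 < run ?test r 1 \<longleftrightarrow> ?d = 1"
      unfolding r using \<open>r 1 = 1\<close> by auto
    ultimately show "K m (run ?test r) xs" unfolding K_def using uv by blast
  qed (auto simp: load_field_def)
  have leaf: "triple 0 (\<lambda>r xs. K m r xs \<and> r 10 < r 1) (Do (merge q)) (\<lambda>r xs. \<exists>m'<m. I m' r xs)" for m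
  proof (rule triple_conseq[OF triple_Do])
    fix r and xs :: "nat list" assume "K m r xs \<and> r 10 < r 1"
    then obtain E' g u v where J: "J m r E' g u v" and uv: "u < n" "v < n"
      and one: "card (nbrs E' u) = 1" unfolding K_def by blast
    have G': "simple_graph {..<n} E'" using G J by (auto simp: J_def intro: simple_graph_mono)
    obtain p where p: "nbrs E' u = {p}" "{u, p} \<in> E'" "u \<in> {..<n}" "p \<in> {..<n}" "u \<noteq> p"
      using leafE[OF G' one] .
    have fin: "finite E'" using finite_edges[OF G'] .
    let ?E = "E' - {{u, p}}" and ?g = "g(u := \<lambda>_. 0, p := join {..<q} (g p) (g u))"
    let ?r = "run (merge q) r"
    have H: "heap q n E' g r" "r 4 = ptr q u" "r 0 = 0" "r 1 = 1" using J by (auto simp: J_def env_def)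
    note M = heap_merge[OF H(1) G' p(1) H(2-4)]
    have anti: "\<forall>x. antitone_cost {..<q} (?g x)"
      using J by (simp add: J_def antitone_join) (simp add: antitone_cost_def)
    have "env q n k r" using J by (simp add: J_def)
    then have env: "env q n k ?r" by (rule env_cong) (use M(3) in auto)
    have "?F E f \<longleftrightarrow> ?F ?E ?g"
      using feasible_leaf[of "{..<n}" E' "{..<q}" u p g k] J p fin by (simp add: J_def)
    \<comment> \<open>The merge isolates \<open>u\<close> and otherwise changes only the degree of
      \<open>p\<close>. So \<open>p\<close> is the only possible new leaf, and the climb moves
      there.\<close>
    moreover have "card (nbrs ?E w) \<noteq> 1" if "w < n" "w \<le> v" "w \<noteq> p" for w
      using J that unfolding nbrs_delete[OF p(5)] by (auto simp: J_def p(1))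
    moreover have "?r 5 = ptr q v" using J M(3)[of 5] by (simp add: J_def)
    ultimately have "J (card ?E + (n - v)) ?r ?E ?g p v"
      unfolding J_def using J M(1,2) env anti p(4) uv by (auto simp: J_def)
    moreover have "card ?E + (n - v) < m"
      using J card_Suc_Diff1[OF fin p(2)] by (simp add: J_def)
    ultimately show "\<exists>m'<m. I m' ?r xs" unfolding I_def by blast
  qed auto
  have next': "triple 0 (\<lambda>r xs. K m r xs \<and> \<not> r 10 < r 1) (Do [Add 5 5 12, Move 4 5])
    (\<lambda>r xs. \<exists>m'<m. I m' r xs)" for m
  proof (rule triple_conseq[OF triple_Do])
    fix r and xs :: "nat list" assume "K m r xs \<and> \<not> r 10 < r 1"
    then obtain E' g u v where J: "J m r E' g u v" and uv: "u < n" "v < n"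
      and no: "card (nbrs E' u) \<noteq> 1" unfolding K_def by blast
    have r: "run [Add 5 5 12, Move 4 5] r = r(5 := ptr q (Suc v), 4 := ptr q (Suc v))"
      using J by (simp add: J_def env_def ptr_Suc)
    \<comment> \<open>The test has just shown that \<open>u\<close> is no leaf, so the exception can
      pass on to the next vertex \<open>Suc v\<close>.\<close>
    have "J (card E' + (n - Suc v)) (r(5 := ptr q (Suc v), 4 := ptr q (Suc v))) E' g (Suc v) (Suc v)"
      using J uv no unfolding J_def by (auto simp: heap_low env_def le_Suc_eq)
    moreover have "card E' + (n - Suc v) < m" using J uv by (simp add: J_def)
    ultimately show "\<exists>m'<m. I m' (run [Add 5 5 12, Move 4 5] r) xs" unfolding r I_def by blast
  qed auto
  show ?thesis unfolding strip_def
  proof (rule triple_conseq[OF triple_While[of I, OF triple_Seq[OF test triple_If[OF leaf next']]]])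
    fix r xs assume *: "env q n k r \<and> heap q n E f r \<and> r 4 = ptr q 0 \<and> r 5 = ptr q 0"
    have "J (card E + n) r E f 0 0" using * f by (auto simp: J_def)
    then show "\<exists>m\<le>b. I m r xs" using b unfolding I_def by blast
  next
    fix r xs assume "(\<exists>m. I m r xs) \<and> \<not> r 5 < r 6"
    then obtain m E' g u v where J: "J m r E' g u v" and "\<not> r 5 < r 6" unfolding I_def by blast
    then have v: "u = n" "v = n" by (auto simp: J_def env_def ptr_less_iff)
    have sub: "E' \<subseteq> E" using J by (simp add: J_def)
    have "E' = {}"
    proof (rule ccontr)
      assume "E' \<noteq> {}"
      moreover have "\<nexists>c. is_cycle {..<n} E' c" using ac is_cycle_mono[OF _ order_refl sub] by blast
      ultimately obtain w where "w < n" "card (nbrs E' w) = 1"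
        using acyclic_has_leaf[OF simple_graph_mono[OF G sub]] by auto
      then show False using J v by (auto simp: J_def)
    qed
    then show "env q n k r \<and> (\<exists>g. heap q n {} g r \<and> (?F E f \<longleftrightarrow> (\<Sum>x<n. g x {..<q}) \<le> k))"
      using J feasible_no_edges[of "{..<n}" "{..<q}" g k] by (auto simp: J_def)
  qed
qed

section \<open>Evaluating the result\<close>

definition add_up :: "nat \<Rightarrow> com" where
  "add_up q = While 4 6 (Do (load_field 9 4 (slot {..<q}) @ [Add 3 3 9, Add 4 4 12]))"

lemma triple_add_up:
  assumes "n \<le> b"
  shows "triple b (\<lambda>r xs. env q n k r \<and> heap q n E g r \<and> r 4 = ptr q 0 \<and> r 3 = 0) (add_up q)
    (\<lambda>r xs. env q n k r \<and> r 3 = (\<Sum>x<n. g x {..<q}))"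
proof -
  define I where "I m r (xs :: nat list) \<longleftrightarrow> (\<exists>v\<le>n. m = n - v \<and> env q n k r \<and> heap q n E g r \<and>
    r 4 = ptr q v \<and> r 3 = (\<Sum>x<v. g x {..<q}))" for m r xs
  let ?code = "load_field 9 4 (slot {..<q}) @ [Add 3 3 9, Add 4 4 12]"
  have body: "triple 0 (\<lambda>r xs. I m r xs \<and> r 4 < r 6) (Do ?code) (\<lambda>r xs. \<exists>m'<m. I m' r xs)" for m
  proof (rule triple_conseq[OF triple_Do])
    fix r and xs :: "nat list" assume "I m r xs \<and> r 4 < r 6"
    then obtain v where v: "v < n" "m = n - v" and r: "env q n k r" "heap q n E g r" "r 4 = ptr q v"
      "r 3 = (\<Sum>x<v. g x {..<q})"
      by (auto simp: I_def env_def ptr_less_iff)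
    have "run ?code r = r(8 := ptr q v + slot {..<q}, 9 := g v {..<q},
        3 := (\<Sum>x<Suc v. g x {..<q}), 4 := ptr q (Suc v))"
      using run_load_field[of r 4 q v 9] r v by (simp add: heap_def env_def ptr_Suc)
    then have "I (n - Suc v) (run ?code r) xs"
      unfolding I_def using r v by (intro exI[of _ "Suc v"]) (simp add: heap_low env_def)
    then show "\<exists>m'<m. I m' (run ?code r) xs" using v by (intro exI[of _ "n - Suc v"]) auto
  qed (auto simp: load_field_def)
  show ?thesis unfolding add_up_def
  proof (rule triple_conseq[OF triple_While[of I, OF body]])
    show "\<exists>m\<le>b. I m r xs"
      if "env q n k r \<and> heap q n E g r \<and> r 4 = ptr q 0 \<and> r 3 = 0" for r xs
      using that assms unfolding I_def by (intro exI[of _ n] conjI exI[of _ 0]) auto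
    show "env q n k r \<and> r 3 = (\<Sum>x<n. g x {..<q})"
      if "(\<exists>m. I m r xs) \<and> \<not> r 4 < r 6" for r xs
    proof -
      from that obtain v where v: "v \<le> n" "\<not> v < n" "env q n k r" "r 3 = (\<Sum>x<v. g x {..<q})"
        by (auto simp: I_def env_def ptr_less_iff)
      then have "v = n" by simp
      then show ?thesis using v by simp
    qed
  qed
qed

text \<open>Register 2 holds \<open>Suc k\<close>, so the final strict comparison tests whether the
  total is at most \<open>k\<close>. The negative answer is already in register 0.\<close>

definition solver :: "nat \<Rightarrow> com" where
  "solver q = Seq (read_header q) (Seq (read_edges q) (Seq (read_terminals q q)
     (Seq (Do [Const 4 (base q), Const 5 (base q)]) (Seq (strip q)
     (Seq (Do [Const 4 (base q), Const 3 0]) (Seq (add_up q)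
     (If 3 2 (Do [Const 0 1]) (Do []))))))))"

text \<open>The bound \<open>2 * card V\<close> comes from the stripping loop, whose potential
  starts at edges plus vertices. The reading loops stay below it because edges and the elements of
  each set are listed without repetition.\<close>

lemma triple_solver:
  assumes inst: "gmwct_instance V E Ss" and len: "length Ss = q" and enc: "encodes xs V E Ss k"
  shows "triple (2 * card V) (\<lambda>r ys. r = (\<lambda>_. 0) \<and> ys = xs) (solver q)
    (\<lambda>r _. r 0 = (if gmwct_yes V E Ss k then 1 else 0))"
proof -
  obtain n es ss where V: "V = {..<n}" and E: "set (map (\<lambda>(u, v). {u, v}) es) = E"
    "distinct (map (\<lambda>(u, v). {u, v}) es)" and ss: "map set ss = Ss" "\<forall>s\<in>set ss. distinct s"
    and xs: "xs = input_word n k es ss"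
    using enc unfolding encodes_def by blast
  have G: "simple_graph {..<n} E" and ac: "\<nexists>c. is_cycle {..<n} E c"
    and sub: "\<And>S. S \<in> set Ss \<Longrightarrow> S \<subseteq> {..<n}"
    using inst by (auto simp: gmwct_instance_def tree_def V)
  have cE: "card E \<le> n" using acyclic_card_edges[OF G ac] by simp
  have "length es = card E" using E distinct_card[OF E(2)] by (simp del: set_map)
  then have les: "length es \<le> 2 * n" using cE by simp
  have lss: "\<forall>s\<in>set ss. set s \<subseteq> {..<n} \<and> length s \<le> 2 * n"
  proof
    fix s assume s: "s \<in> set ss"
    then have "set s \<subseteq> {..<n}" using sub[of "set s"] ss(1) by force
    moreover from this have "card (set s) \<le> n" using card_mono[of "{..<n}" "set s"] by simp
    ultimately show "set s \<subseteq> {..<n} \<and> length s \<le> 2 * n"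
      using ss(2) s distinct_card[of s] by simp
  qed
  have q: "length ss = q" using ss(1) len by auto
  let ?words = "concat (map (\<lambda>s. length s # s) ss)"
  let ?f = "terminal_cost Ss k"
  have yes: "gmwct_yes V E Ss k \<longleftrightarrow> feasible {..<q} {..<n} E ?f k"
    using gmwct_yes_iff_feasible[OF G sub] len V by simp
  have 1: "triple (2 * n) (\<lambda>r ys. r = (\<lambda>_. 0) \<and> ys = xs) (read_header q)
    (\<lambda>r xs. env q n k r \<and> heap q n {} (\<lambda>_ _. 0) r \<and> r 3 = length es \<and>
      xs = concat (map (\<lambda>(u, v). [u, v]) es) @ ?words)"
    by (rule triple_conseq[OF triple_read_header]) (auto simp: xs input_word_def)
  have 2: "triple (2 * n) (\<lambda>r xs. env q n k r \<and> heap q n {} (\<lambda>_ _. 0) r \<and> r 3 = length es \<and>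
      xs = concat (map (\<lambda>(u, v). [u, v]) es) @ ?words) (read_edges q)
    (\<lambda>r xs. env q n k r \<and> heap q n E (\<lambda>_ _. 0) r \<and> xs = ?words)"
    using triple_read_edges[OF _ E(2) les, of n q k "\<lambda>_ _. 0" ?words] G unfolding E(1) by simp
  have 3: "triple (2 * n) (\<lambda>r xs. env q n k r \<and> heap q n E (\<lambda>_ _. 0) r \<and> xs = ?words)
    (read_terminals q q) (\<lambda>r xs. env q n k r \<and> heap q n E ?f r)"
    by (rule triple_conseq[OF triple_read_terminals[OF lss, of q]]) (auto simp: q ss(1))
  have 4: "triple (2 * n) (\<lambda>r xs. env q n k r \<and> heap q n E ?f r)
    (Do [Const 4 (base q), Const 5 (base q)])
    (\<lambda>r xs. env q n k r \<and> heap q n E ?f r \<and> r 4 = ptr q 0 \<and> r 5 = ptr q 0)"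
    by (rule triple_conseq[OF triple_Do]) (auto simp: heap_low env_def ptr_0)
  have 5: "triple (2 * n) (\<lambda>r xs. env q n k r \<and> heap q n E ?f r \<and> r 4 = ptr q 0 \<and> r 5 = ptr q 0)
    (strip q) (\<lambda>r xs. env q n k r \<and> (\<exists>g. heap q n {} g r \<and>
       (gmwct_yes V E Ss k \<longleftrightarrow> (\<Sum>x<n. g x {..<q}) \<le> k)))"
    unfolding yes using cE antitone_terminal_cost by (intro triple_strip[OF G ac]) auto
  have 6: "triple (2 * n) (\<lambda>r xs. env q n k r \<and> heap q n {} g r \<and>
      (gmwct_yes V E Ss k \<longleftrightarrow> (\<Sum>x<n. g x {..<q}) \<le> k))
    (Seq (Do [Const 4 (base q), Const 3 0]) (Seq (add_up q) (If 3 2 (Do [Const 0 1]) (Do []))))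
    (\<lambda>r _. r 0 = (if gmwct_yes V E Ss k then 1 else 0))" for g
  \<comment> \<open>The equivalence does not mention the memory: it holds outright or makes the
    precondition unsatisfiable.\<close>
  proof (cases "gmwct_yes V E Ss k \<longleftrightarrow> (\<Sum>x<n. g x {..<q}) \<le> k")
    case True
    have a: "triple (2 * n) (\<lambda>r xs. env q n k r \<and> heap q n {} g r)
      (Do [Const 4 (base q), Const 3 0])
      (\<lambda>r xs. env q n k r \<and> heap q n {} g r \<and> r 4 = ptr q 0 \<and> r 3 = 0)"
      by (rule triple_conseq[OF triple_Do]) (auto simp: heap_low env_def ptr_0)
    have b: "triple (2 * n) (\<lambda>r xs. env q n k r \<and> r 3 = (\<Sum>x<n. g x {..<q}))
      (If 3 2 (Do [Const 0 1]) (Do [])) (\<lambda>r _. r 0 = (if gmwct_yes V E Ss k then 1 else 0))"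
      using True by (intro triple_If; intro triple_conseq[OF triple_Do]) (auto simp: env_def)
    have "triple (2 * n) (\<lambda>r xs. env q n k r \<and> heap q n {} g r \<and> r 4 = ptr q 0 \<and> r 3 = 0)
      (add_up q) (\<lambda>r xs. env q n k r \<and> r 3 = (\<Sum>x<n. g x {..<q}))"
      by (rule triple_add_up) simp
    note c = triple_Seq[OF a triple_Seq[OF this b]]
    show ?thesis by (rule triple_conseq[OF c]) auto
  qed (simp add: triple_def)
  have 7: "triple (2 * n) (\<lambda>r xs. env q n k r \<and> (\<exists>g. heap q n {} g r \<and>
       (gmwct_yes V E Ss k \<longleftrightarrow> (\<Sum>x<n. g x {..<q}) \<le> k)))
    (Seq (Do [Const 4 (base q), Const 3 0]) (Seq (add_up q) (If 3 2 (Do [Const 0 1]) (Do []))))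
    (\<lambda>r _. r 0 = (if gmwct_yes V E Ss k then 1 else 0))"
    using 6 unfolding triple_def by blast
  show ?thesis unfolding solver_def V card_lessThan
    using triple_Seq[OF 1 triple_Seq[OF 2 triple_Seq[OF 3 triple_Seq[OF 4 triple_Seq[OF 5 7]]]]]
    unfolding V .
qed

theorem theorem5p2:
  fixes q :: nat
  assumes "q \<ge> 1"
  shows "\<exists>(P :: program) (T :: nat \<Rightarrow> nat).
           (\<lambda>n. real (T n)) \<in> O(\<lambda>n. real n) \<and>
           (\<forall>(V :: nat set) (E :: nat set set) (Ss :: nat set list) (k :: nat) (xs :: nat list).
              gmwct_instance V E Ss \<and> length Ss = q \<and> encodes xs V E Ss k \<longrightarrow>
              answers_within P xs (T (card V)) (gmwct_yes V E Ss k))"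
proof (intro exI conjI allI impI)
  let ?T = "\<lambda>n. cost (solver q) * (2 * n + 1)"
  show "(\<lambda>n. real (?T n)) \<in> O(\<lambda>n. real n)"
  proof (rule bigoI[of _ "3 * real (cost (solver q))"], rule eventually_sequentiallyI[of 1])
    fix n :: nat assume "1 \<le> n"
    \<comment> \<open>The additive one is absorbed because \<open>n\<close> is at least one.\<close>
    then have "?T n \<le> cost (solver q) * (3 * n)" by (intro mult_le_mono2) simp
    then have "real (?T n) \<le> real (cost (solver q) * (3 * n))" by (rule of_nat_mono)
    then show "norm (real (?T n)) \<le> 3 * real (cost (solver q)) * norm (real n)" by simp
  qed
  fix V E Ss k xs
  assume "gmwct_instance V E Ss \<and> length Ss = q \<and> encodes xs V E Ss k"
  then show "answers_within (compile 0 (solver q)) xs (?T (card V)) (gmwct_yes V E Ss k)"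
    by (intro triple_answers triple_solver) auto
qed

end
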